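(* Let $n\ge1$, $a\ge0$, $d\ge2$, $1\le e\le d-1$ and $s\ge1$ be integers, and let $\mathbf n=(n,n+a,1)$, $\mathbf d=(1,1,d)$. Suppose that $$\max\{(n+1)(d-e)+1,\ (n+a+1)e+1\}\le s,$$ $$n\ \ge\ (n+1)(d-e+1)-s\ >\ 0,\qquad n+a\ \ge\ (n+a+1)(e+1)-s\ >\ 0.$$ Then $\sigma_s(X_{\mathbf n,\mathbf d})$ is defective. (These are exactly conditions (C0) and (C1) of the general setup for $\mathbf e_0=(1,0,d-e)$, $\mathbf e_1=(0,1,e)$.)
   Context: $K$ is an algebraically closed field of characteristic $0$. For $\mathbf n=(n_0,\dots,n_{k-1})$, $\mathbf d=(d_0,\dots,d_{k-1})$ positive integer tuples, $N(\mathbf n,\mathbf d)=\prod_i\binom{n_i+d_i}{d_i}$ and $D(\mathbf n)=\sum_in_i$. With $V_i$ a $K$-vector space of dimension $n_i+1$, the Segre–Veronese variety $X_{\mathbf n,\mathbf d}\subset\mathbb P(\bigotimes_i\mathrm{Sym}_{d_i}V_i)$ is the image of $\prod_i\mathbb PV_i$ under $([u_i])_i\mapsto[u_0^{d_0}\otimes\cdots\otimes u_{k-1}^{d_{k-1}}]$. $\sigma_s(X)$ is the Zariski closure of the union of linear spans of $s$ linearly independent points of $X$; it is defective if $\dim\sigma_s(X_{\mathbf n,\mathbf d})<\min\{s(D(\mathbf n)+1),N(\mathbf n,\mathbf d)\}-1$. *)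

theory Defs
  imports "HOL-Computational_Algebra.Polynomial"
begin

definition aspace :: "'i set \<Rightarrow> ('i \<Rightarrow> 'a::field) set" where
  "aspace I = {x. \<forall>i. i \<notin> I \<longrightarrow> x i = 0}"

inductive_set polyfun :: "'i set \<Rightarrow> (('i \<Rightarrow> 'a::field) \<Rightarrow> 'a) set" for I where
  pf_const: "(\<lambda>x. c) \<in> polyfun I"
| pf_var: "i \<in> I \<Longrightarrow> (\<lambda>x. x i) \<in> polyfun I"
| pf_add: "p \<in> polyfun I \<Longrightarrow> q \<in> polyfun I \<Longrightarrow> (\<lambda>x. p x + q x) \<in> polyfun I"
| pf_mult: "p \<in> polyfun I \<Longrightarrow> q \<in> polyfun I \<Longrightarrow> (\<lambda>x. p x * q x) \<in> polyfun I"

definition zclosed :: "'i set \<Rightarrow> ('i \<Rightarrow> 'a::field) set \<Rightarrow> bool" where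
  "zclosed I S \<longleftrightarrow> (\<exists>P \<subseteq> polyfun I. S = {x \<in> aspace I. \<forall>p\<in>P. p x = 0})"

definition zclosure :: "'i set \<Rightarrow> ('i \<Rightarrow> 'a::field) set \<Rightarrow> ('i \<Rightarrow> 'a) set" where
  "zclosure I S = \<Inter>{C. zclosed I C \<and> S \<subseteq> C}"

definition zirreducible :: "'i set \<Rightarrow> ('i \<Rightarrow> 'a::field) set \<Rightarrow> bool" where
  "zirreducible I Z \<longleftrightarrow> Z \<noteq> {} \<and>
     (\<forall>A B. zclosed I A \<longrightarrow> zclosed I B \<longrightarrow> Z \<subseteq> A \<union> B \<longrightarrow> Z \<subseteq> A \<or> Z \<subseteq> B)"

definition zdim :: "'i set \<Rightarrow> ('i \<Rightarrow> 'a::field) set \<Rightarrow> nat" where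
  "zdim I V = (GREATEST m. \<exists>Z :: nat \<Rightarrow> ('i \<Rightarrow> 'a) set.
      (\<forall>j\<le>m. zclosed I (Z j) \<and> zirreducible I (Z j) \<and> Z j \<subseteq> V) \<and>
      (\<forall>j<m. Z j \<subset> Z (Suc j)))"

text \<open>Dimension of a projective variety given by its affine cone C (a closed cone):
  dim of the cone minus one.\<close>
definition proj_dim :: "'i set \<Rightarrow> ('i \<Rightarrow> 'a::field) set \<Rightarrow> int" where
  "proj_dim I C = int (zdim I C) - 1"

text \<open>n and d are lists of length k. Coordinates of
  \<Otimes>_i Sym_{d_i} V_i are indexed by tuples of multi-indices \<alpha> i j (i<k, j\<le>n_i)
  with \<Sum>_j \<alpha> i j = d_i.\<close>
definition sv_index :: "nat list \<Rightarrow> nat list \<Rightarrow> (nat \<Rightarrow> nat \<Rightarrow> nat) set" where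
  "sv_index n d = {\<alpha>. (\<forall>i<length n. (\<Sum>j\<le>n!i. \<alpha> i j) = d!i) \<and>
                      (\<forall>i j. (i \<ge> length n \<or> j > n!i) \<longrightarrow> \<alpha> i j = 0)}"

definition Nsv :: "nat list \<Rightarrow> nat list \<Rightarrow> nat" where
  "Nsv n d = (\<Prod>i<length n. (n!i + d!i) choose (d!i))"

definition Dsv :: "nat list \<Rightarrow> nat" where
  "Dsv n = (\<Sum>i<length n. n!i)"

text \<open>The vector u_0^{d_0} \<otimes> ... \<otimes> u_{k-1}^{d_{k-1}} in monomial coordinates,
  u i j being the j-th coordinate of u_i \<in> V_i \<cong> K^{n_i+1}.\<close>
definition sv_vec :: "nat list \<Rightarrow> nat list \<Rightarrow> (nat \<Rightarrow> nat \<Rightarrow> 'a::field) \<Rightarrow> ((nat \<Rightarrow> nat \<Rightarrow> nat) \<Rightarrow> 'a)" where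
  "sv_vec n d u = (\<lambda>\<alpha>. if \<alpha> \<in> sv_index n d
       then (\<Prod>i<length n. \<Prod>j\<le>n!i. u i j ^ \<alpha> i j) else 0)"

text \<open>Affine cone over X_{n,d} (nonzero representatives of its points).\<close>
definition sv_cone :: "nat list \<Rightarrow> nat list \<Rightarrow> ((nat \<Rightarrow> nat \<Rightarrow> nat) \<Rightarrow> 'a::field) set" where
  "sv_cone n d = {sv_vec n d u | u. \<forall>i<length n. \<exists>j\<le>n!i. u i j \<noteq> 0}"

definition lin_indep_fam :: "nat \<Rightarrow> (nat \<Rightarrow> ('i \<Rightarrow> 'a::field)) \<Rightarrow> bool" where
  "lin_indep_fam s v \<longleftrightarrow>
     (\<forall>c. (\<lambda>x. \<Sum>t<s. c t * v t x) = (\<lambda>x. 0) \<longrightarrow> (\<forall>t<s. c t = 0))"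

definition secant_cone :: "nat \<Rightarrow> nat list \<Rightarrow> nat list \<Rightarrow> ((nat \<Rightarrow> nat \<Rightarrow> nat) \<Rightarrow> 'a::field) set" where
  "secant_cone s n d = zclosure (sv_index n d)
     {(\<lambda>x. \<Sum>t<s. c t * v t x) | c v.
        (\<forall>t<s. v t \<in> sv_cone n d) \<and> lin_indep_fam s v}"

definition sigma_defective :: "'a::field itself \<Rightarrow> nat \<Rightarrow> nat list \<Rightarrow> nat list \<Rightarrow> bool" where
  "sigma_defective TYPE('a) s n d \<longleftrightarrow>
     proj_dim (sv_index n d) (secant_cone s n d :: ((nat \<Rightarrow> nat \<Rightarrow> nat) \<Rightarrow> 'a) set)
       < int (min (s * (Dsv n + 1)) (Nsv n d)) - 1"

end

theory Submission
  imports Defs "HOL-Library.FuncSet"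
begin

text \<open>
  Put \<open>A = n + 1\<close>, \<open>B = n + a + 1\<close>, \<open>r = s mod A\<close>, \<open>t = s mod B\<close>. The numerical conditions say that
  \<open>s = A (d - e) + r = B e + t\<close> with \<open>0 < r < A\<close> and \<open>0 < t < B\<close>. The flattening of a tensor to a matrix
  with \<open>A (d - e + 1) = s + (A - r)\<close> rows and \<open>B (e + 1) = s + (B - t)\<close> columns has rank at most \<open>s\<close> on
  the secant variety. At a suitable base point this rank condition is transversal: it lets one solve for
  \<open>(A - r) (B - t)\<close> of the coordinates as power series in the others, so the cone has dimension at most
  \<open>A B (d + 1) - (A - r) (B - t) = s (A + B) - r t\<close>, which is below both expected values.

  For the passage to Krull dimension, a chain of \<open>m + 1\<close> irreducible closed sets produces \<open>m\<close>
  algebraically independent functions, hence \<open>D ^ m\<close> linearly independent ones of degree \<open>O(D)\<close>. Along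
  every line through the base point a function of degree \<open>O(D)\<close> is determined by its Taylor expansion
  to order \<open>O(D)\<close>, and these expansions span a space of dimension \<open>O(D ^ M)\<close>, where \<open>M\<close> is the number
  of free coordinates.
\<close>

section \<open>Chains of irreducible closed sets\<close>

lemma polyfun_sum:
  assumes "finite A" "\<And>e. e \<in> A \<Longrightarrow> f e \<in> polyfun I"
  shows "(\<lambda>x. \<Sum>e\<in>A. c e * f e x) \<in> polyfun I"
  using assms
proof (induction A rule: finite_induct)
  case empty
  then show ?case using pf_const[of 0] by simp
next
  case (insert a A)
  have "(\<lambda>x. c a * f a x + (\<Sum>e\<in>A. c e * f e x)) \<in> polyfun I"
    using insert by (intro pf_add pf_mult pf_const) auto
  then show ?case using insert by simp
qed

lemma polyfun_power:
  assumes "f \<in> polyfun I"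
  shows "(\<lambda>x. f x ^ k) \<in> polyfun I"
  by (induction k) (use assms pf_const[of 1] in \<open>auto intro: pf_mult\<close>)

lemma zclosed_zeros: "p \<in> polyfun I \<Longrightarrow> zclosed I {x \<in> aspace I. p x = 0}"
  unfolding zclosed_def by (intro exI[of _ "{p}"]) auto

lemma zclosed_imp_aspace: "zclosed I Z \<Longrightarrow> Z \<subseteq> aspace I"
  unfolding zclosed_def by auto

lemma zero_on_zclosure:
  assumes "p \<in> polyfun I" "S \<subseteq> aspace I" "\<And>x. x \<in> S \<Longrightarrow> p x = 0" "x \<in> zclosure I S"
  shows "p x = 0"
  using assms zclosed_zeros[OF assms(1)] unfolding zclosure_def by blast

lemma zclosed_separate:
  assumes "zclosed I Z" "x \<in> aspace I" "x \<notin> Z"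
  obtains p where "p \<in> polyfun I" "\<And>z. z \<in> Z \<Longrightarrow> p z = 0" "p x \<noteq> 0"
  using assms unfolding zclosed_def by blast

lemma zclosed_singleton:
  assumes "x \<in> aspace I"
  shows "zclosed I {x :: 'i \<Rightarrow> 'a::field}"
proof -
  define P where "P = {(\<lambda>z. z i + - x i) | i. i \<in> I}"
  have "P \<subseteq> polyfun I"
  proof
    fix p assume "p \<in> P"
    then obtain i where "i \<in> I" "p = (\<lambda>z. z i + - x i)" unfolding P_def by blast
    then show "p \<in> polyfun I" by (simp only:) (intro pf_add pf_var pf_const)
  qed
  moreover have "{x} = {z \<in> aspace I. \<forall>p\<in>P. p z = 0}"
  proof (intro equalityI subsetI)
    fix z assume "z \<in> {z \<in> aspace I. \<forall>p\<in>P. p z = 0}"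
    then have z: "z \<in> aspace I" "\<forall>i\<in>I. z i = x i"
      unfolding P_def by (auto simp: eq_neg_iff_add_eq_0)
    have "z i = x i" for i
      using z assms unfolding aspace_def by (cases "i \<in> I") auto
    then show "z \<in> {x}" by auto
  qed (use assms in \<open>auto simp: P_def\<close>)
  ultimately show ?thesis unfolding zclosed_def by blast
qed

lemma zirreducible_singleton: "zirreducible I {x}"
  unfolding zirreducible_def by auto

text \<open>Irreducibility acts as the absence of zero divisors: \<open>Z\<close> is covered by the
  zero sets of \<open>p\<close> and \<open>q\<close>, hence lies in one of them, and a point where
  \<open>p\<close> does not vanish leaves only that of \<open>q\<close>.\<close>

lemma zirreducible_mult_zero:
  assumes "zirreducible I Z" "Z \<subseteq> aspace I" "p \<in> polyfun I" "q \<in> polyfun I"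
    and "\<And>x. x \<in> Z \<Longrightarrow> p x * q x = 0" and "\<exists>x\<in>Z. p x \<noteq> 0"
    and "x \<in> Z"
  shows "q x = 0"
proof -
  have "Z \<subseteq> {x \<in> aspace I. p x = 0} \<union> {x \<in> aspace I. q x = 0}"
    using assms(2,5) by auto
  then have "Z \<subseteq> {x \<in> aspace I. p x = 0} \<or> Z \<subseteq> {x \<in> aspace I. q x = 0}"
    using assms(1) zclosed_zeros assms(3,4) unfolding zirreducible_def by blast
  then show ?thesis using assms(6,7) by blast
qed

definition indep_on :: "'b set \<Rightarrow> (nat \<Rightarrow> 'b \<Rightarrow> 'a::field) \<Rightarrow> nat \<Rightarrow> bool" where
  "indep_on Z f K \<longleftrightarrow>
     (\<forall>c. (\<forall>x\<in>Z. (\<Sum>e<K. c e * f e x) = 0) \<longrightarrow> (\<forall>e<K. c e = 0))"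

lemma sum_lessThan_add:
  fixes f :: "nat \<Rightarrow> 'a::comm_monoid_add"
  shows "sum f {..<a + b} = sum f {..<a} + (\<Sum>i<b. f (a + i))"
  by (induction b) (auto simp: add.assoc)

text \<open>In a vanishing combination, restriction to \<open>Z\<close> kills every term with a
  positive power of \<open>g\<close>, so the coefficients of the lowest block are zero. The rest is
  divisible by \<open>g\<close>, which cancels on the irreducible \<open>Z'\<close>, and induction
  on \<open>D\<close> continues. The index \<open>e\<close> encodes the exponent
  \<open>e div K\<close> and the function number \<open>e mod K\<close>.\<close>

lemma indep_on_step:
  assumes irr: "zirreducible I Z'" and asp: "Z' \<subseteq> aspace I" and sub: "Z \<subseteq> Z'"
    and g: "g \<in> polyfun I" and g0: "\<And>x. x \<in> Z \<Longrightarrow> g x = 0" and g1: "\<exists>x\<in>Z'. g x \<noteq> 0"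
    and f: "\<And>e. e < K \<Longrightarrow> f e \<in> polyfun I" and ind: "indep_on Z f K" and K: "K > 0"
  shows "indep_on Z' (\<lambda>e x. g x ^ (e div K) * f (e mod K) x) (D * K)"
  unfolding indep_on_def
proof (induction D)
  case 0
  then show ?case by simp
next
  case (Suc D)
  let ?m = "\<lambda>e x. g x ^ (e div K) * f (e mod K) x"
  show ?case
  proof (intro allI impI)
    fix c e assume c: "\<forall>x\<in>Z'. (\<Sum>e<Suc D * K. c e * ?m e x) = 0" and e: "e < Suc D * K"
    \<comment> \<open>\<open>H\<close> is what remains after the lowest block is removed and one
      factor \<open>g\<close> is taken out.\<close>
    define H where "H = (\<lambda>x. \<Sum>e<D * K. c (K + e) * ?m e x)"
    have split: "(\<Sum>e<Suc D * K. c e * ?m e x) = (\<Sum>e<K. c e * f e x) + g x * H x" for x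
    proof -
      have "(\<Sum>e<Suc D * K. c e * ?m e x) = (\<Sum>e<K. c e * ?m e x) + (\<Sum>e<D * K. c (K + e) * ?m (K + e) x)"
        using sum_lessThan_add[of "\<lambda>e. c e * ?m e x" K "D * K"] by simp
      moreover have "(\<Sum>e<K. c e * ?m e x) = (\<Sum>e<K. c e * f e x)"
        by (intro sum.cong) auto
      moreover have "(\<Sum>e<D * K. c (K + e) * ?m (K + e) x) = g x * H x"
        unfolding H_def sum_distrib_left
        by (intro sum.cong) (use K in \<open>auto simp: div_add_self1 mult_ac\<close>)
      ultimately show ?thesis by simp
    qed
    have "(\<Sum>e<K. c e * f e x) = 0" if "x \<in> Z" for x
    proof -
      have "(\<Sum>e<Suc D * K. c e * ?m e x) = 0" using c sub that by blast
      then show ?thesis unfolding split by (simp add: g0[OF that])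
    qed
    then have low: "\<forall>e<K. c e = 0"
      using ind unfolding indep_on_def by blast
    have "g x * H x = 0" if "x \<in> Z'" for x
    proof -
      have "(\<Sum>e<Suc D * K. c e * ?m e x) = 0" using c that by blast
      then show ?thesis unfolding split using low by simp
    qed
    moreover have "H \<in> polyfun I"
      unfolding H_def using K
      by (intro polyfun_sum pf_mult polyfun_power g f) auto
    ultimately have "\<forall>x\<in>Z'. H x = 0"
      using zirreducible_mult_zero[OF irr asp g _ _ g1] by blast
    then have "\<forall>e<D * K. c (K + e) = 0"
      using Suc[rule_format, of "\<lambda>e. c (K + e)"] unfolding H_def by blast
    then have "c e = 0" if "\<not> e < K"
      using that e by (metis add_diff_inverse_nat less_diff_conv2 mult_Suc nat_add_left_cancel_less)
    then show "c e = 0" using low by blast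
  qed
qed

text \<open>Gaussian elimination: the equation at \<open>b\<close> is solved for an unknown with
  nonzero coefficient, and the induction hypothesis treats the reduced system.\<close>

lemma homogeneous_system_solution:
  fixes c :: "nat \<Rightarrow> 'b \<Rightarrow> 'a::field"
  assumes "finite B" "card B < K"
  shows "\<exists>l. (\<exists>e<K. l e \<noteq> 0) \<and> (\<forall>b\<in>B. (\<Sum>e<K. l e * c e b) = 0)"
  using assms
proof (induction B arbitrary: c K rule: finite_induct)
  case empty
  then show ?case by (intro exI[of _ "\<lambda>_. 1"]) auto
next
  case (insert b B)
  then obtain K' where K': "K = Suc K'" "card B < K'"
    by (cases K) auto
  show ?case
  proof (cases "\<forall>e<K. c e b = 0")
    case True
    from insert have "\<exists>l. (\<exists>e<K. l e \<noteq> 0) \<and> (\<forall>b\<in>B. (\<Sum>e<K. l e * c e b) = 0)"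
      by simp
    then show ?thesis using True by (auto intro!: sum.neutral)
  next
    case False
    then obtain p where p: "p < K" "c p b \<noteq> 0" by auto
    \<comment> \<open>\<open>sw\<close> enumerates the unknowns other than the pivot
      \<open>p\<close>.\<close>
    define sw where "sw = (\<lambda>e. if e < p then e else Suc e)"
    have bij: "bij_betw sw {..<K'} ({..<K} - {p})"
    proof (rule bij_betwI[where g = "\<lambda>e. if e < p then e else e - 1"])
    qed (use p K' in \<open>auto simp: sw_def split: if_splits\<close>)
    obtain l where l: "\<exists>e<K'. l e \<noteq> 0"
      "\<And>b'. b' \<in> B \<Longrightarrow> (\<Sum>e<K'. l e * (c (sw e) b' - c (sw e) b / c p b * c p b')) = 0"
      using insert.IH[OF K'(2), of "\<lambda>e b'. c (sw e) b' - c (sw e) b / c p b * c p b'"] by auto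
    define s where "s = (\<Sum>e<K'. l e * c (sw e) b)"
    \<comment> \<open>The pivot takes the value dictated by the equation at \<open>b\<close>; the
      other unknowns are carried over from \<open>l\<close>.\<close>
    define m where "m = (\<lambda>e. if e = p then - s / c p b else l (inv_into {..<K'} sw e))"
    have inv: "inv_into {..<K'} sw (sw e) = e" if "e < K'" for e
      using bij that by (simp add: bij_betw_def inv_into_f_f)
    have msw: "m (sw e) = l e" if "e < K'" for e
      using inv[OF that] by (auto simp: m_def sw_def)
    have S: "(\<Sum>e<K. m e * c e b') = (\<Sum>e<K'. l e * c (sw e) b') - s / c p b * c p b'" for b'
    proof -
      have "(\<Sum>e<K. m e * c e b') = m p * c p b' + (\<Sum>e\<in>{..<K} - {p}. m e * c e b')"
        using p by (simp add: sum.remove)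
      also have "(\<Sum>e\<in>{..<K} - {p}. m e * c e b') = (\<Sum>e<K'. m (sw e) * c (sw e) b')"
        using sum.reindex_bij_betw[OF bij, of "\<lambda>e. m e * c e b'"] by simp
      also have "\<dots> = (\<Sum>e<K'. l e * c (sw e) b')"
        by (intro sum.cong) (auto simp: msw)
      finally show ?thesis by (simp add: m_def)
    qed
    show ?thesis
    proof (intro exI[of _ m] conjI ballI)
      obtain e where "e < K'" "l e \<noteq> 0" using l by auto
      moreover have "sw e < K" using \<open>e < K'\<close> K' by (auto simp: sw_def)
      ultimately show "\<exists>e<K. m e \<noteq> 0" using msw by (intro exI[of _ "sw e"]) auto
    next
      fix b' assume "b' \<in> insert b B"
      then consider "b' = b" | "b' \<in> B" by auto
      then show "(\<Sum>e<K. m e * c e b') = 0"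
      proof cases
        case 1
        then show ?thesis using S[of b] p by (simp add: s_def)
      next
        case 2
        from l(2)[OF 2] have "(\<Sum>e<K'. l e * c (sw e) b') = s / c p b * c p b'"
          by (simp add: s_def algebra_simps sum_subtractf sum_distrib_left sum_divide_distrib)
        then show ?thesis using S[of b'] by simp
      qed
    qed
  qed
qed

section \<open>Truncated expansions along lines\<close>

text \<open>The constants depend neither on \<open>x\<close> nor on the line parameter, so each
  element is one polynomial expression in the \<open>y j\<close>, read along all lines at
  once.\<close>

inductive_set polyalg :: "('j \<Rightarrow> 'x \<Rightarrow> 'a::field poly) \<Rightarrow> 'j set \<Rightarrow> ('x \<Rightarrow> 'a poly) set"
  for y J where
  pa_const: "(\<lambda>x. [:c:]) \<in> polyalg y J"
| pa_var: "j \<in> J \<Longrightarrow> y j \<in> polyalg y J"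
| pa_add: "p \<in> polyalg y J \<Longrightarrow> q \<in> polyalg y J \<Longrightarrow> (\<lambda>x. p x + q x) \<in> polyalg y J"
| pa_mult: "p \<in> polyalg y J \<Longrightarrow> q \<in> polyalg y J \<Longrightarrow> (\<lambda>x. p x * q x) \<in> polyalg y J"

text \<open>Truncated form of being a power series in the \<open>y j\<close>. Since \<open>h\<close>
  is chosen before \<open>x\<close>, one polynomial serves all directions up to order
  \<open>L\<close> in the line parameter.\<close>

definition approx :: "('j \<Rightarrow> 'x \<Rightarrow> 'a::field poly) \<Rightarrow> 'j set \<Rightarrow> nat \<Rightarrow> ('x \<Rightarrow> 'a poly) set" where
  "approx y J L = {z. \<exists>h\<in>polyalg y J. \<forall>x. [:0, 1:] ^ L dvd z x - h x}"

lemma approxI: "h \<in> polyalg y J \<Longrightarrow> (\<And>x. [:0, 1:] ^ L dvd z x - h x) \<Longrightarrow> z \<in> approx y J L"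
  unfolding approx_def by blast

lemma polyalg_approx: "h \<in> polyalg y J \<Longrightarrow> h \<in> approx y J L"
  by (rule approxI) auto

lemma approx_const: "(\<lambda>x. [:c:]) \<in> approx y J L"
  by (intro polyalg_approx pa_const)

lemma approx_add:
  assumes "z \<in> approx y J L" "w \<in> approx y J L"
  shows "(\<lambda>x. z x + w x) \<in> approx y J L"
proof -
  obtain h k where "h \<in> polyalg y J" "k \<in> polyalg y J"
    "\<And>x. [:0, 1:] ^ L dvd z x - h x" "\<And>x. [:0, 1:] ^ L dvd w x - k x"
    using assms unfolding approx_def by blast
  then show ?thesis
    by (intro approxI[of "\<lambda>x. h x + k x"] pa_add) (auto simp: add_diff_add)
qed

lemma approx_mult:
  assumes "z \<in> approx y J L" "w \<in> approx y J L"
  shows "(\<lambda>x. z x * w x) \<in> approx y J L"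
proof -
  obtain h k where *: "h \<in> polyalg y J" "k \<in> polyalg y J"
    "\<And>x. [:0, 1:] ^ L dvd z x - h x" "\<And>x. [:0, 1:] ^ L dvd w x - k x"
    using assms unfolding approx_def by blast
  have eq: "z x * w x - h x * k x = (z x - h x) * w x + h x * (w x - k x)" for x
    by (simp add: algebra_simps)
  show ?thesis
    by (intro approxI[of "\<lambda>x. h x * k x"] pa_mult * dvd_add, unfold eq)
      (intro dvd_add dvd_mult dvd_mult2 *)
qed

lemma approx_sum:
  assumes "finite A" "\<And>e. e \<in> A \<Longrightarrow> z e \<in> approx y J L"
  shows "(\<lambda>x. \<Sum>e\<in>A. z e x) \<in> approx y J L"
  using assms
proof (induction A rule: finite_induct)
  case empty
  then show ?case using approx_const[of 0] by simp
next
  case (insert a A)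
  then show ?case using approx_add[of "z a" y J L "\<lambda>x. \<Sum>e\<in>A. z e x"] by simp
qed

lemma approx_cong:
  assumes "z \<in> approx y J L" "\<And>x. [:0, 1:] ^ L dvd w x - z x"
  shows "w \<in> approx y J L"
proof -
  obtain h where *: "h \<in> polyalg y J" "\<And>x. [:0, 1:] ^ L dvd z x - h x"
    using assms unfolding approx_def by blast
  have "w x - h x = (w x - z x) + (z x - h x)" for x by simp
  then show ?thesis using * assms(2) by (metis approxI dvd_add)
qed

text \<open>Each error term of order \<open>L\<close> is multiplied by a factor that vanishes at
  parameter 0, which gains one order. This gain drives the later induction on the order of
  approximation.\<close>

lemma approx_mult_gain:
  assumes z: "z \<in> approx y J L" "\<And>x. [:0, 1:] dvd z x"
    and w: "w \<in> approx y J L" "\<And>x. [:0, 1:] dvd w x" and L: "L \<ge> 1"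
  shows "(\<lambda>x. z x * w x) \<in> approx y J (Suc L)"
proof -
  obtain h k where *: "h \<in> polyalg y J" "k \<in> polyalg y J"
    "\<And>x. [:0, 1:] ^ L dvd z x - h x" "\<And>x. [:0, 1:] ^ L dvd w x - k x"
    using assms unfolding approx_def by blast
  \<comment> \<open>\<open>h\<close> inherits the zero of \<open>z\<close> at parameter 0 because
    \<open>L\<close> is at least 1.\<close>
  have h: "[:0, 1:] dvd h x" for x
  proof -
    have "[:0, 1:] dvd z x - h x"
      using dvd_trans[OF le_imp_power_dvd[OF L] *(3)[of x]] by simp
    then show ?thesis using z(2)[of x] dvd_diff[of _ "z x" "z x - h x"] by simp
  qed
  have eq: "z x * w x - h x * k x = (z x - h x) * w x + h x * (w x - k x)" for x
    by (simp add: algebra_simps)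
  have "[:0, 1:] ^ Suc L dvd z x * w x - h x * k x" for x
  proof -
    have "[:0, 1:] ^ Suc L dvd (z x - h x) * w x"
      unfolding power_Suc2 by (intro mult_dvd_mono * w)
    moreover have "[:0, 1:] ^ Suc L dvd h x * (w x - k x)"
      unfolding power_Suc by (intro mult_dvd_mono * h)
    ultimately show ?thesis unfolding eq by (rule dvd_add)
  qed
  then show ?thesis
    by (intro approxI[of "\<lambda>x. h x * k x"] pa_mult *) auto
qed

lemma smult_sum_right: "smult c (\<Sum>i\<in>A. f i) = (\<Sum>i\<in>A. smult c (f i))"
  by (induction A rule: infinite_finite_induct) (auto simp: smult_add_right)

lemma dvd_prod_power:
  fixes f :: "'j \<Rightarrow> 'b::comm_semiring_1"
  assumes "finite J" "j \<in> J" "p dvd f j" "k \<le> a j"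
  shows "p ^ k dvd (\<Prod>j\<in>J. f j ^ a j)"
proof -
  have "p ^ k dvd f j ^ a j"
    using assms(3,4) dvd_power_same le_imp_power_dvd dvd_trans by metis
  then show ?thesis using dvd_prodI[OF assms(1,2), of "\<lambda>j. f j ^ a j"] dvd_trans by blast
qed

text \<open>All exponents run over a box, so that the number of monomials is a plain power.\<close>

lemma polyalg_truncate:
  fixes y :: "'j \<Rightarrow> 'x \<Rightarrow> 'a::field poly"
  assumes J: "finite J" and y: "\<And>j x. j \<in> J \<Longrightarrow> [:0, 1:] dvd y j x"
    and z: "z \<in> polyalg y J"
  shows "\<exists>c. \<forall>x. [:0, 1:] ^ Suc L dvd
           z x - (\<Sum>\<alpha>\<in>Pi\<^sub>E J (\<lambda>_. {..L}). smult (c \<alpha>) (\<Prod>j\<in>J. y j x ^ \<alpha> j))"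
proof -
  define B where "B = Pi\<^sub>E J (\<lambda>_::'j. {..L})"
  define mo where "mo = (\<lambda>\<alpha> x. \<Prod>j\<in>J. y j x ^ \<alpha> j)"
  \<comment> \<open>The functions congruent to a combination of box monomials are shown to be closed
    under the operations that generate \<open>polyalg\<close>.\<close>
  define S where "S = {z. \<exists>c. \<forall>x. [:0, 1:] ^ Suc L dvd z x - (\<Sum>\<alpha>\<in>B. smult (c \<alpha>) (mo \<alpha> x))}"
  have finB: "finite B" unfolding B_def using J by (intro finite_PiE) auto
  have S_E: "\<exists>c. \<forall>x. [:0, 1:] ^ Suc L dvd p x - (\<Sum>\<alpha>\<in>B. smult (c \<alpha>) (mo \<alpha> x))"
    if "p \<in> S" for p
    using that unfolding S_def mem_Collect_eq .
  have S_add: "(\<lambda>x. p x + q x) \<in> S" if pq: "p \<in> S" "q \<in> S" for p q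
  proof -
    obtain c where c: "\<forall>x. [:0, 1:] ^ Suc L dvd p x - (\<Sum>\<alpha>\<in>B. smult (c \<alpha>) (mo \<alpha> x))"
      using S_E[OF pq(1)] by (rule exE)
    obtain c' where c': "\<forall>x. [:0, 1:] ^ Suc L dvd q x - (\<Sum>\<alpha>\<in>B. smult (c' \<alpha>) (mo \<alpha> x))"
      using S_E[OF pq(2)] by (rule exE)
    have "[:0, 1:] ^ Suc L dvd (p x + q x) - (\<Sum>\<alpha>\<in>B. smult (c \<alpha> + c' \<alpha>) (mo \<alpha> x))" for x
      unfolding smult_add_left sum.distrib add_diff_add by (intro dvd_add c[rule_format] c'[rule_format])
    then show ?thesis unfolding S_def by (auto intro!: exI[of _ "\<lambda>\<alpha>. c \<alpha> + c' \<alpha>"])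
  qed
  have S_smult: "(\<lambda>x. smult k (p x)) \<in> S" if p: "p \<in> S" for p k
  proof -
    obtain c where "\<forall>x. [:0, 1:] ^ Suc L dvd p x - (\<Sum>\<alpha>\<in>B. smult (c \<alpha>) (mo \<alpha> x))"
      using S_E[OF p] by (rule exE)
    then have "[:0, 1:] ^ Suc L dvd smult k (p x - (\<Sum>\<alpha>\<in>B. smult (c \<alpha>) (mo \<alpha> x)))" for x
      by (intro dvd_smult) (rule spec)
    then have "[:0, 1:] ^ Suc L dvd smult k (p x) - (\<Sum>\<alpha>\<in>B. smult (k * c \<alpha>) (mo \<alpha> x))" for x
      by (simp add: smult_diff_right smult_sum_right)
    then show ?thesis unfolding S_def by (auto intro!: exI[of _ "\<lambda>\<alpha>. k * c \<alpha>"])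
  qed
  have S_dvd: "p \<in> S" if "\<And>x. [:0, 1:] ^ Suc L dvd p x" for p
    unfolding S_def using that by (auto intro!: exI[of _ "\<lambda>\<alpha>. 0"])
  have S_sum: "(\<lambda>x. \<Sum>e\<in>A. p e x) \<in> S" if "finite A" "\<And>e. e \<in> A \<Longrightarrow> p e \<in> S"
    for A :: "('j \<Rightarrow> nat) set" and p
    using that
  proof (induction A rule: finite_induct)
    case empty
    then show ?case by (intro S_dvd) auto
  next
    case (insert a A)
    then show ?case using S_add[of "p a" "\<lambda>x. \<Sum>e\<in>A. p e x"] by simp
  qed
  have S_mo: "mo \<alpha> \<in> S" for \<alpha>
  proof (cases "\<forall>j\<in>J. \<alpha> j \<le> L")
    case True
    \<comment> \<open>Elements of \<open>B\<close> are extensional; restricting to \<open>J\<close>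
      leaves the monomial unchanged.\<close>
    then have "restrict \<alpha> J \<in> B" unfolding B_def by auto
    moreover have "mo (restrict \<alpha> J) = mo \<alpha>" unfolding mo_def by (auto intro!: ext prod.cong)
    ultimately have "mo \<alpha> x = (\<Sum>\<beta>\<in>B. smult (if \<beta> = restrict \<alpha> J then 1 else 0) (mo \<beta> x))" for x
      using finB by (simp add: if_distrib[of "\<lambda>c. smult c _"] sum.delta cong: if_cong)
    then show ?thesis unfolding S_def
      by (auto intro!: exI[of _ "\<lambda>\<beta>. if \<beta> = restrict \<alpha> J then 1 else 0"])
  next
    case False
    \<comment> \<open>A monomial that leaves the box has order above \<open>L\<close>, as every
      \<open>y j\<close> vanishes at parameter 0.\<close>
    then obtain j where j: "j \<in> J" "Suc L \<le> \<alpha> j" by auto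
    have "[:0, 1:] ^ Suc L dvd mo \<alpha> x" for x
      unfolding mo_def using dvd_prod_power[where f = "\<lambda>j. y j x" and a = \<alpha>, OF J j(1) y[OF j(1)] j(2)] .
    then show ?thesis by (rule S_dvd)
  qed
  have S_cong: "p \<in> S" if q: "q \<in> S" "\<And>x. [:0, 1:] ^ Suc L dvd p x - q x" for p q
    using S_add[OF q(1) S_dvd[of "\<lambda>x. p x - q x"]] q(2) by simp
  have S_mult: "(\<lambda>x. p x * q x) \<in> S" if pq: "p \<in> S" "q \<in> S" for p q
  proof -
    obtain c where c: "\<forall>x. [:0, 1:] ^ Suc L dvd p x - (\<Sum>\<alpha>\<in>B. smult (c \<alpha>) (mo \<alpha> x))"
      using S_E[OF pq(1)] by (rule exE)
    obtain c' where c': "\<forall>x. [:0, 1:] ^ Suc L dvd q x - (\<Sum>\<alpha>\<in>B. smult (c' \<alpha>) (mo \<alpha> x))"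
      using S_E[OF pq(2)] by (rule exE)
    define h k where "h x = (\<Sum>\<alpha>\<in>B. smult (c \<alpha>) (mo \<alpha> x))"
      and "k x = (\<Sum>\<alpha>\<in>B. smult (c' \<alpha>) (mo \<alpha> x))" for x
    \<comment> \<open>The added exponents may leave the box; \<open>S_mo\<close> covers arbitrary
      exponents.\<close>
    have hk: "h x * k x = (\<Sum>\<alpha>\<in>B. \<Sum>\<beta>\<in>B. smult (c \<alpha> * c' \<beta>) (mo (\<lambda>j. \<alpha> j + \<beta> j) x))" for x
      unfolding h_def k_def sum_product
      by (intro sum.cong) (auto simp: mo_def power_add prod.distrib mult.commute)
    have "(\<lambda>x. h x * k x) \<in> S"
      unfolding hk by (intro S_sum finB S_smult S_mo)
    moreover have "[:0, 1:] ^ Suc L dvd p x * q x - h x * k x" for x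
    proof -
      have "p x * q x - h x * k x = (p x - h x) * q x + h x * (q x - k x)"
        by (simp add: algebra_simps)
      moreover have "[:0, 1:] ^ Suc L dvd (p x - h x) * q x"
        unfolding h_def by (intro dvd_mult2 c[rule_format])
      moreover have "[:0, 1:] ^ Suc L dvd h x * (q x - k x)"
        unfolding k_def by (intro dvd_mult c'[rule_format])
      ultimately show ?thesis by (metis dvd_add)
    qed
    ultimately show ?thesis by (rule S_cong)
  qed
  have "z \<in> S" using z
  proof induction
    case (pa_const c)
    have "mo (\<lambda>_. 0) = (\<lambda>x. 1)" unfolding mo_def by simp
    then have "(\<lambda>x. smult c 1) \<in> S" using S_smult[OF S_mo[of "\<lambda>_. 0"]] by simp
    then show ?case by simp
  next
    case (pa_var j)
    have "(\<Prod>i\<in>J. y i x ^ (if i = j then 1 else 0)) = y j x" for x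
    proof -
      have "(\<Prod>i\<in>J. y i x ^ (if i = j then 1 else 0)) = (\<Prod>i\<in>J. if i = j then y i x else 1)"
        by (intro prod.cong) auto
      then show ?thesis using J pa_var by simp
    qed
    then have "mo (\<lambda>i. if i = j then 1 else 0) = y j" unfolding mo_def by (simp add: fun_eq_iff)
    then show ?case using S_mo by metis
  qed (auto intro: S_add S_mult)
  then show ?thesis unfolding S_def B_def mo_def by auto
qed

lemma approx_truncate:
  fixes y :: "'j \<Rightarrow> 'x \<Rightarrow> 'a::field poly"
  assumes "finite J" "\<And>j x. j \<in> J \<Longrightarrow> [:0, 1:] dvd y j x" "z \<in> approx y J (Suc L)"
  shows "\<exists>c. \<forall>x. [:0, 1:] ^ Suc L dvd
           z x - (\<Sum>\<alpha>\<in>Pi\<^sub>E J (\<lambda>_. {..L}). smult (c \<alpha>) (\<Prod>j\<in>J. y j x ^ \<alpha> j))"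
proof -
  obtain h where h: "h \<in> polyalg y J" "\<And>x. [:0, 1:] ^ Suc L dvd z x - h x"
    using assms(3) unfolding approx_def by blast
  obtain c where c: "\<And>x. [:0, 1:] ^ Suc L dvd
      h x - (\<Sum>\<alpha>\<in>Pi\<^sub>E J (\<lambda>_. {..L}). smult (c \<alpha>) (\<Prod>j\<in>J. y j x ^ \<alpha> j))"
    using polyalg_truncate[OF assms(1,2) h(1)] by blast
  show ?thesis
  proof (intro exI[of _ c] allI)
    fix x
    show "[:0, 1:] ^ Suc L dvd
        z x - (\<Sum>\<alpha>\<in>Pi\<^sub>E J (\<lambda>_. {..L}). smult (c \<alpha>) (\<Prod>j\<in>J. y j x ^ \<alpha> j))"
      using dvd_add[OF h(2)[of x] c[of x]] by (simp only: add_diff_eq diff_add_cancel)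
  qed
qed

text \<open>Turns a congruence of high order into an identity once the degree is known to be
  smaller.\<close>

lemma dvd_power_degree_less_zero:
  fixes p :: "'a::field poly"
  assumes "[:0, 1:] ^ Suc L dvd p" "degree p \<le> L"
  shows "p = 0"
proof (rule ccontr)
  assume "p \<noteq> 0"
  then have "degree ([:0, 1:] ^ Suc L :: 'a poly) \<le> degree p"
    using assms(1) by (intro dvd_imp_degree_le)
  then show False using assms(2) by (simp add: degree_power_eq)
qed

text \<open>\<open>\<Phi> x\<close> is the curve that the parametrisation traces along the line through the base point
  in direction \<open>x\<close>; \<open>y\<close> are local coordinates centred at the base point.\<close>

locale line_expansion =
  fixes I :: "'i set" and \<Phi> :: "'x \<Rightarrow> 'i \<Rightarrow> 'a::field poly"
    and y :: "'j \<Rightarrow> 'x \<Rightarrow> 'a poly" and J :: "'j set" and b :: nat and S :: "('i \<Rightarrow> 'a) set"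
  assumes finite_J: "finite J"
    and y_order: "\<And>j x. j \<in> J \<Longrightarrow> [:0, 1:] dvd y j x"
    and \<Phi>_degree: "\<And>i x. i \<in> I \<Longrightarrow> degree (\<Phi> x i) \<le> b"
    and \<Phi>_approx: "\<And>i L. i \<in> I \<Longrightarrow> (\<lambda>x. \<Phi> x i) \<in> approx y J L"
    and S_aspace: "S \<subseteq> aspace I"
    and S_param: "\<And>z. z \<in> S \<Longrightarrow> \<exists>x. z = (\<lambda>i. poly (\<Phi> x i) 1)"
begin

text \<open>\<open>f\<close> is a mere function, so its pullback to the curves is represented by
  chosen polynomials \<open>G x\<close>. The bound \<open>D\<close> is a degree in the line
  parameter, not in the coordinates.\<close>

definition line_lift :: "nat \<Rightarrow> (('i \<Rightarrow> 'a) \<Rightarrow> 'a) \<Rightarrow> ('x \<Rightarrow> 'a poly) \<Rightarrow> bool" where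
  "line_lift D f G \<longleftrightarrow> (\<forall>x. degree (G x) \<le> D) \<and>
     (\<forall>x \<tau>. poly (G x) \<tau> = f (\<lambda>i. poly (\<Phi> x i) \<tau>)) \<and> (\<forall>L. G \<in> approx y J L)"

definition bdeg :: "nat \<Rightarrow> (('i \<Rightarrow> 'a) \<Rightarrow> 'a) \<Rightarrow> bool" where
  "bdeg D f \<longleftrightarrow> f \<in> polyfun I \<and> (\<exists>G. line_lift D f G)"

lemma bdeg_const: "bdeg D (\<lambda>x. c)"
  unfolding bdeg_def
proof (intro conjI exI)
  show "line_lift D (\<lambda>x. c) (\<lambda>x. [:c:])"
    by (simp add: line_lift_def approx_const)
qed (rule pf_const)

lemma bdeg_mult:
  assumes "bdeg D f" "bdeg E g"
  shows "bdeg (D + E) (\<lambda>x. f x * g x)"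
proof -
  obtain F G where F: "line_lift D f F" and G: "line_lift E g G"
    using assms unfolding bdeg_def by auto
  have "degree (F x * G x) \<le> D + E" for x
    using degree_mult_le[of "F x" "G x"] F G add_mono order_trans unfolding line_lift_def by blast
  then have "line_lift (D + E) (\<lambda>x. f x * g x) (\<lambda>x. F x * G x)"
    using F G by (simp add: line_lift_def approx_mult)
  then show ?thesis using assms pf_mult unfolding bdeg_def by blast
qed

lemma bdeg_mono:
  assumes "bdeg D f" "D \<le> E"
  shows "bdeg E f"
proof -
  obtain F where F: "line_lift D f F" using assms unfolding bdeg_def by auto
  then have "line_lift E f F" using assms(2) order_trans unfolding line_lift_def by blast
  then show ?thesis using assms(1) unfolding bdeg_def by blast
qed

lemma bdeg_add:
  assumes "bdeg D f" "bdeg D g"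
  shows "bdeg D (\<lambda>x. f x + g x)"
proof -
  obtain F G where F: "line_lift D f F" and G: "line_lift D g G"
    using assms unfolding bdeg_def by auto
  then have "line_lift D (\<lambda>x. f x + g x) (\<lambda>x. F x + G x)"
    by (simp add: line_lift_def approx_add degree_add_le)
  then show ?thesis using assms pf_add unfolding bdeg_def by blast
qed

lemma bdeg_power: "bdeg D f \<Longrightarrow> bdeg (k * D) (\<lambda>x. f x ^ k)"
proof (induction k)
  case 0
  show ?case using bdeg_const[of 0 1] by simp
next
  case (Suc k)
  then show ?case using bdeg_mult[OF Suc.prems Suc.IH] by simp
qed

lemma polyfun_bdeg: "f \<in> polyfun I \<Longrightarrow> \<exists>D. bdeg D f"
proof (induction rule: polyfun.induct)
  case (pf_const c)
  show ?case using bdeg_const by blast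
next
  case (pf_var i)
  have "line_lift b (\<lambda>x. x i) (\<lambda>x. \<Phi> x i)"
    using pf_var by (simp add: line_lift_def \<Phi>_degree \<Phi>_approx)
  then have "\<exists>G. line_lift b (\<lambda>x. x i) G"
    by (rule exI[of "line_lift b (\<lambda>x. x i)" "\<lambda>x. \<Phi> x i"])
  then have "bdeg b (\<lambda>x. x i)"
    by (simp only: bdeg_def polyfun.pf_var[OF pf_var] simp_thms)
  then show ?case ..
next
  case (pf_add p q)
  then obtain D E where "bdeg D p" "bdeg E q" by blast
  then have "bdeg (max D E) (\<lambda>x. p x + q x)"
    by (metis bdeg_add bdeg_mono max.cobounded1 max.cobounded2)
  then show ?case ..
next
  case (pf_mult p q)
  then obtain D E where "bdeg D p" "bdeg E q" by blast
  then have "bdeg (D + E) (\<lambda>x. p x * q x)" by (rule bdeg_mult)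
  then show ?case ..
qed

text \<open>Modulo order \<open>L + 1\<close> all pullbacks lie in the span of
  \<open>(L + 1) ^ card J\<close> monomials, so more functions than that admit a relation, with
  coefficients independent of \<open>x\<close>. The degree bound \<open>L\<close> makes the relation
  exact on each curve.\<close>

lemma bdeg_dependent:
  assumes f: "\<And>e. e < K \<Longrightarrow> bdeg L (f e)" and K: "K > Suc L ^ card J"
  shows "\<not> indep_on (zclosure I S) f K"
proof -
  have "\<exists>G. line_lift L (f e) G" if "e < K" for e
    using f[OF that] unfolding bdeg_def by blast
  then obtain G where "\<And>e. e < K \<Longrightarrow> line_lift L (f e) (G e)"
    by metis
  then have G: "\<And>e x. e < K \<Longrightarrow> degree (G e x) \<le> L"
    "\<And>e x \<tau>. e < K \<Longrightarrow> poly (G e x) \<tau> = f e (\<lambda>i. poly (\<Phi> x i) \<tau>)"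
    "\<And>e L. e < K \<Longrightarrow> G e \<in> approx y J L"
    unfolding line_lift_def by blast+
  define B where "B = Pi\<^sub>E J (\<lambda>_::'j. {..L})"
  define mo where "mo = (\<lambda>\<alpha> x. \<Prod>j\<in>J. y j x ^ \<alpha> j)"
  have "\<exists>c. \<forall>x. [:0, 1:] ^ Suc L dvd G e x - (\<Sum>\<alpha>\<in>B. smult (c \<alpha>) (mo \<alpha> x))" if "e < K" for e
    unfolding B_def mo_def using approx_truncate[OF finite_J y_order G(3)[OF that]] by blast
  then obtain c where c: "\<And>e x. e < K \<Longrightarrow>
      [:0, 1:] ^ Suc L dvd G e x - (\<Sum>\<alpha>\<in>B. smult (c e \<alpha>) (mo \<alpha> x))"
    by metis
  have "finite B" "card B < K"
    unfolding B_def using finite_J K by (auto intro: finite_PiE simp: card_PiE)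
  then obtain l where l: "\<exists>e<K. l e \<noteq> 0" "\<And>\<alpha>. \<alpha> \<in> B \<Longrightarrow> (\<Sum>e<K. l e * c e \<alpha>) = 0"
    using homogeneous_system_solution[of B K c] by blast
  have zero: "(\<Sum>e<K. smult (l e) (G e x)) = 0" for x
  proof (rule dvd_power_degree_less_zero)
    have "(\<Sum>e<K. smult (l e) (\<Sum>\<alpha>\<in>B. smult (c e \<alpha>) (mo \<alpha> x))) =
        (\<Sum>e<K. \<Sum>\<alpha>\<in>B. smult (l e * c e \<alpha>) (mo \<alpha> x))"
      by (simp add: smult_sum_right)
    also have "\<dots> = (\<Sum>\<alpha>\<in>B. smult (\<Sum>e<K. l e * c e \<alpha>) (mo \<alpha> x))"
      unfolding smult_sum by (rule sum.swap)
    also have "\<dots> = 0" using l(2) by simp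
    finally have "(\<Sum>e<K. smult (l e) (G e x)) =
        (\<Sum>e<K. smult (l e) (G e x - (\<Sum>\<alpha>\<in>B. smult (c e \<alpha>) (mo \<alpha> x))))"
      by (simp add: smult_diff_right sum_subtractf)
    also have "[:0, 1:] ^ Suc L dvd \<dots>"
      using c by (intro dvd_sum dvd_smult) auto
    finally show "[:0, 1:] ^ Suc L dvd (\<Sum>e<K. smult (l e) (G e x))" .
    show "degree (\<Sum>e<K. smult (l e) (G e x)) \<le> L"
      using G(1) by (intro degree_sum_le order_trans[OF degree_smult_le]) auto
  qed
  have vanish: "(\<Sum>e<K. l e * f e z) = 0" if zS: "z \<in> S" for z
  proof -
    \<comment> \<open>The point \<open>z\<close> is reached at parameter 1 of a suitable
      curve.\<close>
    obtain x where x: "z = (\<lambda>i. poly (\<Phi> x i) 1)" using S_param[OF zS] by blast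
    have "(\<Sum>e<K. l e * f e z) = poly (\<Sum>e<K. smult (l e) (G e x)) 1"
      unfolding x poly_sum by (intro sum.cong) (auto simp: G(2))
    then show ?thesis by (simp add: zero)
  qed
  \<comment> \<open>The relation is itself a polynomial function, so it extends from
    \<open>S\<close> to the closure.\<close>
  have "(\<lambda>z. \<Sum>e<K. l e * f e z) \<in> polyfun I"
    using f by (intro polyfun_sum) (auto simp: bdeg_def)
  then have "\<forall>z\<in>zclosure I S. (\<Sum>e<K. l e * f e z) = 0"
    using zero_on_zclosure[OF _ S_aspace] vanish by blast
  then show ?thesis using l(1) unfolding indep_on_def by blast
qed

text \<open>Choosing a function that vanishes on each member of the chain but not on the next one gives
  algebraically independent functions; \<open>D ^ m\<close> counts their monomials.\<close>

lemma chain_indep: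
  assumes "\<forall>j\<le>m. zclosed I (Z j) \<and> zirreducible I (Z j)" "\<forall>j<m. Z j \<subset> Z (Suc j)"
  shows "\<exists>\<delta>. \<forall>D\<ge>1. \<exists>f. indep_on (Z m) f (D ^ m) \<and> (\<forall>e<D ^ m. bdeg (D * \<delta>) (f e))"
  using assms
proof (induction m)
  case 0
  then have "Z 0 \<noteq> {}" unfolding zirreducible_def by auto
  then have "indep_on (Z 0) (\<lambda>e x. 1) 1" unfolding indep_on_def by auto
  then show ?case by (auto intro!: exI[of _ "\<lambda>e x. 1"] bdeg_const)
next
  case (Suc m)
  then obtain \<delta> where \<delta>: "\<And>D. D \<ge> 1 \<Longrightarrow>
      \<exists>f. indep_on (Z m) f (D ^ m) \<and> (\<forall>e<D ^ m. bdeg (D * \<delta>) (f e))"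
    by auto
  have Zm: "zclosed I (Z m)" "zclosed I (Z (Suc m))" "zirreducible I (Z (Suc m))" "Z m \<subset> Z (Suc m)"
    using Suc.prems by auto
  then obtain x where x: "x \<in> Z (Suc m)" "x \<notin> Z m" by blast
  then obtain g where g: "g \<in> polyfun I" "\<And>z. z \<in> Z m \<Longrightarrow> g z = 0" "g x \<noteq> 0"
    using zclosed_separate[OF Zm(1), of x] zclosed_imp_aspace[OF Zm(2)] by blast
  obtain \<gamma> where \<gamma>: "bdeg \<gamma> g" using polyfun_bdeg[OF g(1)] by blast
  show ?case
  proof (intro exI[of _ "\<gamma> + \<delta>"] allI impI)
    fix D :: nat assume D: "D \<ge> 1"
    obtain f where f: "indep_on (Z m) f (D ^ m)" "\<And>e. e < D ^ m \<Longrightarrow> bdeg (D * \<delta>) (f e)"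
      using \<delta>[OF D] by blast
    define K where "K = D ^ m"
    have K: "K > 0" unfolding K_def using D by simp
    have "indep_on (Z (Suc m)) (\<lambda>e x. g x ^ (e div K) * f (e mod K) x) (D * K)"
      using f x g K Zm zclosed_imp_aspace[OF Zm(2)] unfolding K_def
      by (intro indep_on_step[where I = I and Z = "Z m"]) (auto simp: bdeg_def)
    moreover have "bdeg (D * (\<gamma> + \<delta>)) (\<lambda>x. g x ^ (e div K) * f (e mod K) x)" if "e < D * K" for e
    proof (rule bdeg_mono)
      show "bdeg ((e div K) * \<gamma> + D * \<delta>) (\<lambda>x. g x ^ (e div K) * f (e mod K) x)"
        using K f(2) \<gamma> unfolding K_def by (intro bdeg_mult bdeg_power) auto
      \<comment> \<open>Exponents of \<open>g\<close> are at most \<open>D\<close>, so the degree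
        bound grows linearly in \<open>D\<close>.\<close>
      have "e div K \<le> D" using less_mult_imp_div_less[OF that] by simp
      then show "(e div K) * \<gamma> + D * \<delta> \<le> D * (\<gamma> + \<delta>)" by (simp add: algebra_simps)
    qed
    ultimately show "\<exists>f. indep_on (Z (Suc m)) f (D ^ Suc m) \<and>
        (\<forall>e<D ^ Suc m. bdeg (D * (\<gamma> + \<delta>)) (f e))"
      unfolding K_def by (intro exI[of _ "\<lambda>e x. g x ^ (e div D ^ m) * f (e mod D ^ m) x"]) simp
  qed
qed

text \<open>With \<open>M = card J\<close>, a chain of length \<open>M + 1\<close> would give
  \<open>D ^ (M + 1)\<close> independent functions of degree bound \<open>D * \<delta>\<close>,
  whereas at most \<open>(D * \<delta> + 1) ^ M\<close> can be independent.\<close>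

lemma chain_length_le:
  assumes "\<forall>j\<le>m. zclosed I (Z j) \<and> zirreducible I (Z j) \<and> Z j \<subseteq> zclosure I S"
    "\<forall>j<m. Z j \<subset> Z (Suc j)"
  shows "m \<le> card J"
proof (rule ccontr)
  define M where "M = card J"
  assume "\<not> m \<le> card J"
  then have m: "Suc M \<le> m" by (simp add: M_def)
  then obtain \<delta> where \<delta>: "\<And>D. D \<ge> 1 \<Longrightarrow> \<exists>f. indep_on (Z (Suc M)) f (D ^ Suc M) \<and>
      (\<forall>e<D ^ Suc M. bdeg (D * \<delta>) (f e))"
    using chain_indep[of "Suc M" Z] assms by auto
  \<comment> \<open>This exceeds \<open>(\<delta> + 1) ^ M\<close>, so \<open>D ^ (M + 1)\<close>
    beats \<open>(D * (\<delta> + 1)) ^ M\<close>.\<close>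
  define D where "D = Suc (Suc \<delta> ^ M)"
  obtain f where f: "indep_on (Z (Suc M)) f (D ^ Suc M)" "\<And>e. e < D ^ Suc M \<Longrightarrow> bdeg (D * \<delta>) (f e)"
    using \<delta>[of D] by (auto simp: D_def)
  have "Suc (D * \<delta>) ^ M \<le> (D * Suc \<delta>) ^ M"
    by (intro power_mono) (auto simp: D_def)
  also have "\<dots> < D ^ Suc M"
    unfolding power_mult_distrib power_Suc2 by (intro mult_strict_left_mono) (auto simp: D_def)
  finally have "\<not> indep_on (zclosure I S) f (D ^ Suc M)"
    using bdeg_dependent[of "D ^ Suc M" "D * \<delta>" f] f(2) unfolding M_def by blast
  moreover have "Z (Suc M) \<subseteq> zclosure I S" using assms(1) m by blast
  ultimately show False using f(1) unfolding indep_on_def by blast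
qed

lemma zdim_le:
  assumes "S \<noteq> {}"
  shows "zdim I (zclosure I S) \<le> card J"
proof -
  let ?P = "\<lambda>m. \<exists>Z :: nat \<Rightarrow> ('i \<Rightarrow> 'a) set.
      (\<forall>j\<le>m. zclosed I (Z j) \<and> zirreducible I (Z j) \<and> Z j \<subseteq> zclosure I S) \<and>
      (\<forall>j<m. Z j \<subset> Z (Suc j))"
  obtain x where x: "x \<in> S" using assms by blast
  \<comment> \<open>\<open>GREATEST\<close> needs an attained value as well as a bound: a single
    point is a chain of length 0.\<close>
  then have "?P 0"
    using S_aspace
    by (intro exI[of _ "\<lambda>_. {x}"]) (auto simp: zclosed_singleton zirreducible_singleton zclosure_def)
  moreover have "\<forall>m. ?P m \<longrightarrow> m \<le> card J" using chain_length_le by blast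
  ultimately have "?P (GREATEST m. ?P m)" using GreatestI_nat[of ?P 0 "card J"] by blast
  then show ?thesis unfolding zdim_def using chain_length_le by blast
qed

end

section \<open>Residue classes as interpolation nodes\<close>

text \<open>These index the summands of the base point whose unit vector, in a factor of dimension
  \<open>A\<close>, is the \<open>i\<close>-th one.\<close>

definition residue_nodes :: "nat \<Rightarrow> nat \<Rightarrow> nat \<Rightarrow> nat set" where
  "residue_nodes A s i = {t. t < s \<and> t mod A = i}"

lemma finite_residue_nodes [simp]: "finite (residue_nodes A s i)"
  unfolding residue_nodes_def by simp

lemma residue_nodes_image:
  assumes "i < A"
  shows "residue_nodes A s i = (\<lambda>k. k * A + i) ` {k. k * A + i < s}"
proof (intro equalityI subsetI)
  fix t assume "t \<in> residue_nodes A s i"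
  then have "t < s" "t = (t div A) * A + i"
    unfolding residue_nodes_def by (auto simp: div_mult_mod_eq)
  then show "t \<in> (\<lambda>k. k * A + i) ` {k. k * A + i < s}" by (metis image_eqI mem_Collect_eq)
qed (use assms in \<open>auto simp: residue_nodes_def\<close>)

lemma card_residue_nodes_le:
  assumes "i < A"
  shows "card (residue_nodes A s i) \<le> Suc (s div A)"
proof -
  have "k \<le> s div A" if "k * A + i < s" for k
    using that assms by (simp add: less_eq_div_iff_mult_less_eq)
  then have "{k. k * A + i < s} \<subseteq> {..s div A}" by auto
  then have "card {k. k * A + i < s} \<le> Suc (s div A)"
    using card_mono[of "{..s div A}"] by simp
  moreover have "card (residue_nodes A s i) \<le> card {k. k * A + i < s}"
    unfolding residue_nodes_image[OF assms]
    using \<open>{k. k * A + i < s} \<subseteq> {..s div A}\<close> finite_subset by (intro card_image_le) blast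
  ultimately show ?thesis by linarith
qed

text \<open>Only the classes below \<open>s mod A\<close> receive an extra node. For the others the
  vanishing polynomial has degree exactly \<open>s div A\<close>, the degree available in the
  flattening.\<close>

lemma card_residue_nodes_eq:
  assumes "i < A" "s mod A \<le> i"
  shows "card (residue_nodes A s i) = s div A"
proof -
  have "k * A + i < s \<longleftrightarrow> k < s div A" for k
  proof
    assume "k < s div A"
    then have "Suc k * A \<le> s div A * A" by (intro mult_le_mono1) simp
    then show "k * A + i < s" using assms div_mult_mod_eq[of s A] mult_Suc[of k A] by linarith
  next
    assume *: "k * A + i < s"
    show "k < s div A"
    proof (rule ccontr)
      assume "\<not> k < s div A"
      then have "s div A * A \<le> k * A" by (intro mult_le_mono1) simp
      then show False using * assms div_mult_mod_eq[of s A] by linarith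
    qed
  qed
  then have "residue_nodes A s i = (\<lambda>k. k * A + i) ` {..<s div A}"
    unfolding residue_nodes_image[OF assms(1)] by auto
  moreover have "inj_on (\<lambda>k. k * A + i) {..<s div A}"
    using assms by (auto simp: inj_on_def)
  ultimately show ?thesis by (simp add: card_image)
qed

definition vanishing_poly :: "nat set \<Rightarrow> 'a::field_char_0 poly" where
  "vanishing_poly N = (\<Prod>t\<in>N. [:- of_nat t, 1:])"

definition lagrange_poly :: "nat set \<Rightarrow> nat \<Rightarrow> 'a::field_char_0 poly" where
  "lagrange_poly N t =
     smult (inverse (poly (vanishing_poly (N - {t})) (of_nat t))) (vanishing_poly (N - {t}))"

text \<open>Characteristic 0 makes \<open>of_nat\<close> injective, so different indices are
  different nodes.\<close>

lemma poly_vanishing_poly_eq_0_iff: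
  assumes "finite N"
  shows "poly (vanishing_poly N) (of_nat t :: 'a::field_char_0) = 0 \<longleftrightarrow> t \<in> N"
  unfolding vanishing_poly_def poly_prod using assms by (auto simp: prod_zero_iff)

lemma degree_vanishing_poly: "degree (vanishing_poly N :: 'a::field_char_0 poly) = card N"
  unfolding vanishing_poly_def by (subst degree_prod_eq_sum_degree) auto

lemma lead_coeff_vanishing_poly: "coeff (vanishing_poly N :: 'a::field_char_0 poly) (card N) = 1"
  using lead_coeff_prod[of "\<lambda>t. [:- of_nat t, 1:] :: 'a poly" N] degree_vanishing_poly[of N, where ?'a = 'a]
  by (simp add: vanishing_poly_def)

lemma poly_lagrange_poly:
  assumes "finite N" "t' \<in> N"
  shows "poly (lagrange_poly N t) (of_nat t' :: 'a::field_char_0) = of_bool (t' = t)"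
proof (cases "t' = t")
  case True
  have "poly (vanishing_poly (N - {t})) (of_nat t :: 'a) \<noteq> 0"
    using assms by (subst poly_vanishing_poly_eq_0_iff) auto
  then show ?thesis using True by (simp add: lagrange_poly_def)
next
  case False
  have "poly (vanishing_poly (N - {t})) (of_nat t' :: 'a) = 0"
    using assms False by (subst poly_vanishing_poly_eq_0_iff) auto
  then show ?thesis using False by (simp add: lagrange_poly_def)
qed

lemma degree_lagrange_poly_le:
  assumes "finite N" "t \<in> N"
  shows "degree (lagrange_poly N t :: 'a::field_char_0 poly) \<le> card N - 1"
  unfolding lagrange_poly_def
  using order_trans[OF degree_smult_le] degree_vanishing_poly[of "N - {t}", where ?'a = 'a] assms by simp

section \<open>Neumann series\<close>

text \<open>The \<open>k\<close>-th term \<open>(-P)^k Q\<close> of the Neumann series for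
  \<open>(1 + P)^(-1) Q\<close>.\<close>

primrec neumann :: "nat \<Rightarrow> (nat \<Rightarrow> nat \<Rightarrow> 'b::comm_ring_1) \<Rightarrow> (nat \<Rightarrow> 'b) \<Rightarrow> nat \<Rightarrow> nat \<Rightarrow> 'b" where
  "neumann s P Q 0 = Q"
| "neumann s P Q (Suc k) = (\<lambda>a. - (\<Sum>b<s. P a b * neumann s P Q k b))"

lemma neumann_dvd:
  assumes "\<And>a b. a < s \<Longrightarrow> b < s \<Longrightarrow> p dvd P a b" "\<And>a. a < s \<Longrightarrow> p dvd Q a" "a < s"
  shows "p ^ Suc k dvd neumann s P Q k a"
  using assms(3)
proof (induction k arbitrary: a)
  case 0
  then show ?case using assms by simp
next
  case (Suc k)
  have "p ^ Suc (Suc k) dvd P a b * neumann s P Q k b" if "b < s" for b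
    unfolding power_Suc[of p "Suc k"] using Suc that assms(1) by (intro mult_dvd_mono) auto
  then show ?case by (auto intro!: dvd_sum simp del: power_Suc)
qed

lemma sum_of_bool_delta:
  fixes f :: "nat \<Rightarrow> 'b::comm_ring_1"
  assumes "a < s"
  shows "(\<Sum>b<s. of_bool (a = b) * f b) = f a"
proof -
  have "(\<Sum>b<s. of_bool (a = b) * f b) = (\<Sum>b<s. if a = b then f b else 0)"
    by (intro sum.cong) auto
  then show ?thesis using assms by simp
qed

lemma sum_matrix_assoc:
  fixes u :: "nat \<Rightarrow> 'b::comm_ring_1"
  shows "(\<Sum>b<s. (\<Sum>t<s. u t * Z t b) * v b) = (\<Sum>t<s. u t * (\<Sum>b<s. Z t b * v b))"
  unfolding sum_distrib_left sum_distrib_right mult.assoc by (rule sum.swap)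

text \<open>With \<open>P = X Z - 1\<close> and \<open>N = Z X - 1\<close> one has \<open>P X = X N\<close>, so the Neumann series of \<open>P\<close> applied
  to \<open>X w\<close> is \<open>X\<close> times that of \<open>N\<close>, and the sum telescopes.\<close>

lemma neumann_push:
  fixes X Z :: "nat \<Rightarrow> nat \<Rightarrow> 'b::comm_ring_1"
  assumes "a < s"
  shows "neumann s (\<lambda>a b. (\<Sum>t<s. X a t * Z t b) - of_bool (a = b)) (\<lambda>a. \<Sum>t<s. X a t * w t) k a =
    (\<Sum>t<s. X a t * neumann s (\<lambda>t t'. (\<Sum>b<s. Z t b * X b t') - of_bool (t = t')) w k t)"
  using assms
proof (induction k arbitrary: a)
  case 0
  then show ?case by simp
next
  case (Suc k)
  let ?v = "neumann s (\<lambda>a b. (\<Sum>t<s. X a t * Z t b) - of_bool (a = b)) (\<lambda>a. \<Sum>t<s. X a t * w t) k"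
  let ?w = "neumann s (\<lambda>t t'. (\<Sum>b<s. Z t b * X b t') - of_bool (t = t')) w k"
  have IH: "?v b = (\<Sum>t<s. X b t * ?w t)" if "b < s" for b using Suc.IH[OF that] .
  have "(\<Sum>b<s. ((\<Sum>t<s. X a t * Z t b) - of_bool (a = b)) * ?v b) =
      (\<Sum>t<s. X a t * (\<Sum>b<s. Z t b * ?v b)) - ?v a"
    using Suc.prems by (simp add: left_diff_distrib sum_subtractf sum_of_bool_delta sum_matrix_assoc)
  also have "(\<Sum>t<s. X a t * (\<Sum>b<s. Z t b * ?v b)) =
      (\<Sum>t<s. X a t * (\<Sum>b<s. Z t b * (\<Sum>t'<s. X b t' * ?w t')))"
    by (intro sum.cong refl arg_cong2[where f = "(*)"]) (auto simp: IH)
  also have "\<dots> = (\<Sum>t<s. X a t * (\<Sum>t'<s. (\<Sum>b<s. Z t b * X b t') * ?w t'))"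
    by (simp add: sum_matrix_assoc)
  finally have 1: "(\<Sum>b<s. ((\<Sum>t<s. X a t * Z t b) - of_bool (a = b)) * ?v b) =
      (\<Sum>t<s. X a t * (\<Sum>t'<s. (\<Sum>b<s. Z t b * X b t') * ?w t')) - ?v a" .
  have 2: "(\<Sum>t<s. X a t * - (\<Sum>t'<s. ((\<Sum>b<s. Z t b * X b t') - of_bool (t = t')) * ?w t')) =
      - (\<Sum>t<s. X a t * (\<Sum>t'<s. (\<Sum>b<s. Z t b * X b t') * ?w t')) + (\<Sum>t<s. X a t * ?w t)"
  proof -
    have "X a t * - (\<Sum>t'<s. ((\<Sum>b<s. Z t b * X b t') - of_bool (t = t')) * ?w t') =
        - (X a t * (\<Sum>t'<s. (\<Sum>b<s. Z t b * X b t') * ?w t')) + X a t * ?w t" if "t < s" for t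
      using that by (simp add: left_diff_distrib sum_subtractf sum_of_bool_delta right_diff_distrib)
    then show ?thesis by (simp add: sum_negf sum.distrib[symmetric] sum_negf[symmetric] del: sum_negf)
  qed
  show ?case
    unfolding neumann.simps 1 2 using IH[OF Suc.prems] by simp
qed

text \<open>Formally \<open>u Z (X Z)^(-1) X w = u w\<close>: the Schur complement of a matrix that
  factors through dimension \<open>s\<close> vanishes. Stopping the series after \<open>L\<close>
  terms leaves the remainder on the right.\<close>

lemma neumann_telescope:
  fixes X Z :: "nat \<Rightarrow> nat \<Rightarrow> 'b::comm_ring_1" and s :: nat
  defines "P \<equiv> \<lambda>a b. (\<Sum>t<s. X a t * Z t b) - of_bool (a = b)"
    and "N \<equiv> \<lambda>t t'. (\<Sum>b<s. Z t b * X b t') - of_bool (t = t')"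
  shows "(\<Sum>k<L. \<Sum>b<s. (\<Sum>t<s. u t * Z t b) * neumann s P (\<lambda>a. \<Sum>t<s. X a t * w t) k b) =
    (\<Sum>t<s. u t * w t) - (\<Sum>t<s. u t * neumann s N w L t)"
proof (induction L)
  case 0
  then show ?case by simp
next
  case (Suc L)
  let ?w = "neumann s N w L"
  have "(\<Sum>b<s. (\<Sum>t<s. u t * Z t b) * neumann s P (\<lambda>a. \<Sum>t<s. X a t * w t) L b) =
      (\<Sum>b<s. (\<Sum>t<s. u t * Z t b) * (\<Sum>t<s. X b t * ?w t))"
    unfolding P_def N_def by (intro sum.cong) (auto simp: neumann_push)
  also have "\<dots> = (\<Sum>t<s. u t * (\<Sum>t'<s. (\<Sum>b<s. Z t b * X b t') * ?w t'))"
    by (simp add: sum_matrix_assoc)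
  \<comment> \<open>Here \<open>Z X = 1 + N\<close>, and \<open>N\<close> applied to the
    \<open>L\<close>-th term is minus the next term.\<close>
  also have "\<dots> = (\<Sum>t<s. u t * (?w t - neumann s N w (Suc L) t))"
    by (intro sum.cong refl arg_cong2[where f = "(*)"])
      (auto simp: N_def left_diff_distrib sum_subtractf sum_of_bool_delta)
  finally show ?case
    unfolding sum.lessThan_Suc Suc by (simp only: right_diff_distrib sum_subtractf) simp
qed

section \<open>The flattening near the base point\<close>

text \<open>The base point is the sum over \<open>t < s\<close> of the pure tensors built from the unit vectors \<open>t mod A\<close> and
  \<open>t mod B\<close> and the point \<open>(1, t)\<close> of the line. Below, \<open>p\<close> and \<open>q\<close> stand for \<open>d - e\<close> and \<open>e\<close>.\<close>

definition base_vec :: "nat \<Rightarrow> nat \<Rightarrow> nat \<Rightarrow> nat \<Rightarrow> nat \<Rightarrow> 'a::field_char_0" where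
  "base_vec A B t m j =
     (if m = 0 then of_bool (j = t mod A) else if m = 1 then of_bool (j = t mod B)
      else if j = 0 then 1 else of_nat t)"

definition line_vec ::
  "nat \<Rightarrow> nat \<Rightarrow> (nat \<Rightarrow> nat \<Rightarrow> nat \<Rightarrow> 'a::field_char_0) \<Rightarrow> nat \<Rightarrow> nat \<Rightarrow> nat \<Rightarrow> 'a poly" where
  "line_vec A B x t m j = [:base_vec A B t m j, x t m j:]"

text \<open>A row or column functional at the \<open>t\<close>-th summand: \<open>f\<close>,
  homogenized to degree \<open>D\<close> in the two coordinates of the line factor, times coordinate
  \<open>c\<close> of factor \<open>m\<close>.\<close>

definition hom_eval ::
  "nat \<Rightarrow> nat \<Rightarrow> nat \<Rightarrow> nat \<Rightarrow> nat \<Rightarrow> 'a::field_char_0 poly \<Rightarrow> (nat \<Rightarrow> nat \<Rightarrow> nat \<Rightarrow> 'a) \<Rightarrow> nat \<Rightarrow> 'a poly" where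
  "hom_eval A B m c D f x t = line_vec A B x t m c *
     (\<Sum>k\<le>D. smult (coeff f k) (line_vec A B x t 2 0 ^ (D - k) * line_vec A B x t 2 1 ^ k))"

definition coord ::
  "nat \<Rightarrow> nat \<Rightarrow> nat \<Rightarrow> nat \<Rightarrow> nat \<Rightarrow> nat \<Rightarrow> nat \<Rightarrow> (nat \<Rightarrow> nat \<Rightarrow> nat \<Rightarrow> 'a::field_char_0) \<Rightarrow> 'a poly" where
  "coord A B s d i j k x = (\<Sum>t<s. line_vec A B x t 0 i * line_vec A B x t 1 j *
      (line_vec A B x t 2 0 ^ (d - k) * line_vec A B x t 2 1 ^ k))"

definition ccoord ::
  "nat \<Rightarrow> nat \<Rightarrow> nat \<Rightarrow> nat \<Rightarrow> nat \<Rightarrow> nat \<Rightarrow> nat \<Rightarrow> (nat \<Rightarrow> nat \<Rightarrow> nat \<Rightarrow> 'a::field_char_0) \<Rightarrow> 'a poly" where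
  "ccoord A B s d i j k x = coord A B s d i j k x - [:poly (coord A B s d i j k x) 0:]"

text \<open>The flattening gives degree \<open>p\<close> of the line factor to the rows and degree
  \<open>q\<close> to the columns. Written as a sum over \<open>t < s\<close>, its matrix visibly
  factors through dimension \<open>s\<close>.\<close>

definition flat_entry ::
  "nat \<Rightarrow> nat \<Rightarrow> nat \<Rightarrow> nat \<Rightarrow> nat \<Rightarrow> nat \<Rightarrow> 'a::field_char_0 poly \<Rightarrow> nat \<Rightarrow> 'a poly \<Rightarrow>
    (nat \<Rightarrow> nat \<Rightarrow> nat \<Rightarrow> 'a) \<Rightarrow> 'a poly" where
  "flat_entry A B s p q i f j g x = (\<Sum>t<s. hom_eval A B 0 i p f x t * hom_eval A B 1 j q g x t)"

lemma X_dvd_iff: "[:0, 1:] dvd (f :: 'a::field poly) \<longleftrightarrow> poly f 0 = 0"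
  using poly_eq_0_iff_dvd[of f 0] by simp

lemma poly_line_vec_0 [simp]: "poly (line_vec A B x t m j) 0 = base_vec A B t m j"
  by (simp add: line_vec_def)

lemma poly_hom_eval_0:
  assumes "degree f \<le> D"
  shows "poly (hom_eval A B m c D f x t) 0 = base_vec A B t m c * poly f (of_nat t)"
proof -
  have "poly f (of_nat t :: 'a) = (\<Sum>k\<le>D. coeff f k * of_nat t ^ k)"
    unfolding poly_altdef using assms by (intro sum.mono_neutral_left) (auto simp: coeff_eq_0)
  then show ?thesis
    by (simp add: hom_eval_def poly_sum base_vec_def[of A B t 2])
qed

text \<open>Exponents add when binary forms are multiplied, so the flattening has Hankel shape in
  \<open>k\<close> and \<open>l\<close> and its entries are linear in the coordinates of the
  tensor.\<close>

lemma flat_entry_eq: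
  "flat_entry A B s p q i f j g x =
     (\<Sum>k\<le>p. \<Sum>l\<le>q. smult (coeff f k * coeff g l) (coord A B s (p + q) i j (k + l) x))"
proof -
  define U where "U = line_vec A B x"
  have "hom_eval A B 0 i p f x t * hom_eval A B 1 j q g x t =
      (\<Sum>k\<le>p. \<Sum>l\<le>q. smult (coeff f k * coeff g l)
        (U t 0 i * U t 1 j * (U t 2 0 ^ (p + q - (k + l)) * U t 2 1 ^ (k + l))))" for t
  proof -
    have "hom_eval A B 0 i p f x t * hom_eval A B 1 j q g x t = U t 0 i * U t 1 j *
        (\<Sum>k\<le>p. \<Sum>l\<le>q. smult (coeff f k) (U t 2 0 ^ (p - k) * U t 2 1 ^ k) *
          smult (coeff g l) (U t 2 0 ^ (q - l) * U t 2 1 ^ l))"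
      unfolding hom_eval_def U_def sum_product[symmetric] by (simp only: mult_ac)
    also have "\<dots> = (\<Sum>k\<le>p. \<Sum>l\<le>q. U t 0 i * U t 1 j *
        (smult (coeff f k) (U t 2 0 ^ (p - k) * U t 2 1 ^ k) *
          smult (coeff g l) (U t 2 0 ^ (q - l) * U t 2 1 ^ l)))"
      by (simp only: sum_distrib_left)
    also have "\<dots> = (\<Sum>k\<le>p. \<Sum>l\<le>q. smult (coeff f k * coeff g l)
        (U t 0 i * U t 1 j * (U t 2 0 ^ (p + q - (k + l)) * U t 2 1 ^ (k + l))))"
    proof (intro sum.cong refl)
      fix k l assume "k \<in> {..p}" "l \<in> {..q}"
      then have "p + q - (k + l) = (p - k) + (q - l)" by auto
      then show "U t 0 i * U t 1 j * (smult (coeff f k) (U t 2 0 ^ (p - k) * U t 2 1 ^ k) *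
            smult (coeff g l) (U t 2 0 ^ (q - l) * U t 2 1 ^ l)) =
          smult (coeff f k * coeff g l)
            (U t 0 i * U t 1 j * (U t 2 0 ^ (p + q - (k + l)) * U t 2 1 ^ (k + l)))"
        by (simp add: power_add mult_ac)
    qed
    finally show ?thesis .
  qed
  then have "flat_entry A B s p q i f j g x = (\<Sum>t<s. \<Sum>k\<le>p. \<Sum>l\<le>q. smult (coeff f k * coeff g l)
        (U t 0 i * U t 1 j * (U t 2 0 ^ (p + q - (k + l)) * U t 2 1 ^ (k + l))))"
    unfolding flat_entry_def by simp
  also have "\<dots> = (\<Sum>k\<le>p. \<Sum>t<s. \<Sum>l\<le>q. smult (coeff f k * coeff g l)
        (U t 0 i * U t 1 j * (U t 2 0 ^ (p + q - (k + l)) * U t 2 1 ^ (k + l))))"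
    by (rule sum.swap)
  also have "\<dots> = (\<Sum>k\<le>p. \<Sum>l\<le>q. \<Sum>t<s. smult (coeff f k * coeff g l)
        (U t 0 i * U t 1 j * (U t 2 0 ^ (p + q - (k + l)) * U t 2 1 ^ (k + l))))"
    by (intro sum.cong refl sum.swap)
  finally show ?thesis
    unfolding coord_def U_def smult_sum_right .
qed

lemma flat_entry_centered:
  "flat_entry A B s p q i f j g x - [:poly (flat_entry A B s p q i f j g x) 0:] =
     (\<Sum>k\<le>p. \<Sum>l\<le>q. smult (coeff f k * coeff g l) (ccoord A B s (p + q) i j (k + l) x))"
proof -
  have const: "[:\<Sum>i\<in>M. h i:] = (\<Sum>i\<in>M. [:h i:])" for M and h :: "nat \<Rightarrow> 'a"
  proof (induction M rule: infinite_finite_induct)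
    case (insert x F)
    have "[:h x + sum h F:] = [:h x:] + [:sum h F:]" by simp
    then show ?case using insert by simp
  qed auto
  have "[:poly (flat_entry A B s p q i f j g x) 0:] =
      (\<Sum>k\<le>p. \<Sum>l\<le>q. smult (coeff f k * coeff g l) [:poly (coord A B s (p + q) i j (k + l) x) 0:])"
    unfolding flat_entry_eq poly_sum by (simp add: const)
  then show ?thesis
    unfolding flat_entry_eq ccoord_def by (simp add: smult_diff_right sum_subtractf)
qed

lemma ccoord_order: "[:0, 1:] dvd ccoord A B s d i j k x"
  by (simp add: X_dvd_iff ccoord_def)

lemma approx_smult:
  assumes "z \<in> approx y J L"
  shows "(\<lambda>x. smult c (z x)) \<in> approx y J L"
  using approx_mult[OF approx_const[of c] assms] by simp

lemma approx_uminus: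
  assumes "z \<in> approx y J L"
  shows "(\<lambda>x. - z x) \<in> approx y J L"
  using approx_smult[OF assms, of "-1"] by simp

section \<open>Rows and columns adapted to the base point\<close>

locale flattening =
  fixes A B s p q :: nat
  assumes A: "A > 0" and B: "B > 0" and p: "s div A = p" and q: "s div B = q"
begin

text \<open>The coordinates left out are the top ones (\<open>k = p + q\<close>) in the classes
  without an extra node on either side; the rank condition determines them from the others.\<close>

definition free_coords :: "(nat \<times> nat \<times> nat) set" where
  "free_coords = {..<A} \<times> {..<B} \<times> {..p + q} - {s mod A..<A} \<times> {s mod B..<B} \<times> {p + q}"

definition local_coord :: "nat \<times> nat \<times> nat \<Rightarrow> (nat \<Rightarrow> nat \<Rightarrow> nat \<Rightarrow> 'a::field_char_0) \<Rightarrow> 'a poly" where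
  "local_coord = (\<lambda>(i, j, k). ccoord A B s (p + q) i j k)"

lemma card_free_coords:
  "card free_coords = A * B * (p + q + 1) - (A - s mod A) * (B - s mod B)"
proof -
  have "card free_coords = card ({..<A} \<times> {..<B} \<times> {..p + q}) -
      card ({s mod A..<A} \<times> {s mod B..<B} \<times> {p + q})"
    unfolding free_coords_def by (rule card_Diff_subset) auto
  then show ?thesis by (simp add: card_cartesian_product algebra_simps)
qed

abbreviation nodesA :: "nat \<Rightarrow> nat set" where "nodesA \<equiv> residue_nodes A s"
abbreviation nodesB :: "nat \<Rightarrow> nat set" where "nodesB \<equiv> residue_nodes B s"

text \<open>A class has at most \<open>p + 1\<close> nodes, and the Lagrange polynomial drops one of
  them.\<close>

lemma degree_lagrange_A: "t < s \<Longrightarrow> degree (lagrange_poly (nodesA (t mod A)) t :: 'a::field_char_0 poly) \<le> p"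
  using degree_lagrange_poly_le[of "nodesA (t mod A)" t, where ?'a = 'a]
    card_residue_nodes_le[of "t mod A" A s] A p by (simp add: residue_nodes_def)

lemma degree_lagrange_B: "t < s \<Longrightarrow> degree (lagrange_poly (nodesB (t mod B)) t :: 'a::field_char_0 poly) \<le> q"
  using degree_lagrange_poly_le[of "nodesB (t mod B)" t, where ?'a = 'a]
    card_residue_nodes_le[of "t mod B" B s] B q by (simp add: residue_nodes_def)

text \<open>At the base point the functionals \<open>rowA a\<close> with \<open>a < s\<close> are
  dual to the \<open>s\<close> summands, while \<open>kerA i\<close> with
  \<open>s mod A \<le> i < A\<close> vanish on all of them; \<open>colB\<close> and
  \<open>kerB\<close> do the same for columns. There the flattening is an identity block bordered by
  zeros.\<close>

definition rowA :: "nat \<Rightarrow> (nat \<Rightarrow> nat \<Rightarrow> nat \<Rightarrow> 'a::field_char_0) \<Rightarrow> nat \<Rightarrow> 'a poly" where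
  "rowA a x t = hom_eval A B 0 (a mod A) p (lagrange_poly (nodesA (a mod A)) a) x t"

definition colB :: "nat \<Rightarrow> (nat \<Rightarrow> nat \<Rightarrow> nat \<Rightarrow> 'a::field_char_0) \<Rightarrow> nat \<Rightarrow> 'a poly" where
  "colB b x t = hom_eval A B 1 (b mod B) q (lagrange_poly (nodesB (b mod B)) b) x t"

definition kerA :: "nat \<Rightarrow> (nat \<Rightarrow> nat \<Rightarrow> nat \<Rightarrow> 'a::field_char_0) \<Rightarrow> nat \<Rightarrow> 'a poly" where
  "kerA i x t = hom_eval A B 0 i p (vanishing_poly (nodesA i)) x t"

definition kerB :: "nat \<Rightarrow> (nat \<Rightarrow> nat \<Rightarrow> nat \<Rightarrow> 'a::field_char_0) \<Rightarrow> nat \<Rightarrow> 'a poly" where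
  "kerB j x t = hom_eval A B 1 j q (vanishing_poly (nodesB j)) x t"

lemma rowA_0: "a < s \<Longrightarrow> t < s \<Longrightarrow> poly (rowA a x t) 0 = of_bool (a = t)"
  unfolding rowA_def using degree_lagrange_A[of a]
  by (subst poly_hom_eval_0)
    (auto simp: base_vec_def poly_lagrange_poly residue_nodes_def)

lemma colB_0: "b < s \<Longrightarrow> t < s \<Longrightarrow> poly (colB b x t) 0 = of_bool (b = t)"
  unfolding colB_def using degree_lagrange_B[of b]
  by (subst poly_hom_eval_0)
    (auto simp: base_vec_def poly_lagrange_poly residue_nodes_def)

lemma kerA_0:
  fixes x :: "nat \<Rightarrow> nat \<Rightarrow> nat \<Rightarrow> 'a::field_char_0"
  assumes "s mod A \<le> i" "i < A" "t < s"
  shows "poly (kerA i x t) 0 = 0"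
proof -
  have "degree (vanishing_poly (nodesA i) :: 'a poly) \<le> p"
    using assms p by (simp add: degree_vanishing_poly card_residue_nodes_eq)
  then have "poly (kerA i x t) 0 = of_bool (i = t mod A) * poly (vanishing_poly (nodesA i)) (of_nat t)"
    by (simp add: kerA_def poly_hom_eval_0 base_vec_def)
  also have "\<dots> = 0"
    using assms(3) poly_vanishing_poly_eq_0_iff[of "nodesA i" t, where ?'a = 'a]
    by (auto simp: residue_nodes_def)
  finally show ?thesis .
qed

lemma kerB_0:
  fixes x :: "nat \<Rightarrow> nat \<Rightarrow> nat \<Rightarrow> 'a::field_char_0"
  assumes "s mod B \<le> j" "j < B" "t < s"
  shows "poly (kerB j x t) 0 = 0"
proof -
  have "degree (vanishing_poly (nodesB j) :: 'a poly) \<le> q"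
    using assms q by (simp add: degree_vanishing_poly card_residue_nodes_eq)
  then have "poly (kerB j x t) 0 = of_bool (j = t mod B) * poly (vanishing_poly (nodesB j)) (of_nat t)"
    by (simp add: kerB_def poly_hom_eval_0 base_vec_def)
  also have "\<dots> = 0"
    using assms(3) poly_vanishing_poly_eq_0_iff[of "nodesB j" t, where ?'a = 'a]
    by (auto simp: residue_nodes_def)
  finally show ?thesis .
qed

lemma flat_entry_approx:
  fixes f g :: "'a::field_char_0 poly"
  assumes "\<And>i j k. i < A \<Longrightarrow> j < B \<Longrightarrow> k \<le> p + q \<Longrightarrow>
      ccoord A B s (p + q) i j k \<in> approx (local_coord :: _ \<Rightarrow> _ \<Rightarrow> 'a poly) free_coords L"
    and "i < A" "j < B"
  shows "(\<lambda>x. flat_entry A B s p q i f j g x - [:poly (flat_entry A B s p q i f j g x) 0:])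
    \<in> approx local_coord free_coords L"
  unfolding flat_entry_centered using assms by (intro approx_sum approx_smult) auto

text \<open>The block of the flattening that vanishes at the base point is a power series in the other
  blocks, because the flattening has rank at most \<open>s\<close>.\<close>

lemma kernel_block_approx:
  assumes IH: "\<And>i j k. i < A \<Longrightarrow> j < B \<Longrightarrow> k \<le> p + q \<Longrightarrow>
      ccoord A B s (p + q) i j k \<in> approx (local_coord :: _ \<Rightarrow> _ \<Rightarrow> 'a::field_char_0 poly) free_coords L"
    and L: "L \<ge> 1" and i: "s mod A \<le> i" "i < A" and j: "s mod B \<le> j" "j < B"
  shows "(\<lambda>x. \<Sum>t<s. kerA i x t * kerB j x t) \<in>
    approx (local_coord :: _ \<Rightarrow> _ \<Rightarrow> 'a poly) free_coords (Suc L)"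
proof -
  let ?ap = "approx (local_coord :: _ \<Rightarrow> _ \<Rightarrow> 'a poly) free_coords"
  \<comment> \<open>For the matrices \<open>X\<close> of \<open>rowA\<close> and \<open>Z\<close> of
    \<open>colB\<close>, these are \<open>P = X Z - 1\<close>, the two border blocks
    \<open>Q\<close> and \<open>R\<close>, and \<open>N = Z X - 1\<close>. Only the order of
    vanishing of \<open>N\<close> matters, as it is not built from flattening entries.\<close>
  define P where "P = (\<lambda>x a b. (\<Sum>t<s. rowA a x t * (colB b x t :: 'a poly)) - of_bool (a = b))"
  define Q where "Q = (\<lambda>x a. \<Sum>t<s. rowA a x t * (kerB j x t :: 'a poly))"
  define R where "R = (\<lambda>x b. \<Sum>t<s. kerA i x t * (colB b x t :: 'a poly))"
  define N where "N = (\<lambda>x t t'. (\<Sum>b<s. colB b x t * (rowA b x t' :: 'a poly)) - of_bool (t = t'))"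
  have of_bool_0: "poly (of_bool c :: 'a poly) 0 = of_bool c" for c by simp
  have P0: "poly (P x a b) 0 = 0" if "a < s" "b < s" for x a b
    unfolding P_def poly_diff poly_sum poly_mult of_bool_0
    using that by (simp add: rowA_0 colB_0 sum_of_bool_delta eq_commute[of b a])
  have N0: "poly (N x a b) 0 = 0" if "a < s" "b < s" for x a b
    unfolding N_def poly_diff poly_sum poly_mult of_bool_0
    using that by (simp add: rowA_0 colB_0 eq_commute[of _ a] sum_of_bool_delta)
  have Q0: "poly (Q x a) 0 = 0" if "a < s" for x a
    unfolding Q_def poly_sum poly_mult by (simp add: kerB_0[OF j])
  have R0: "poly (R x b) 0 = 0" if "b < s" for x b
    unfolding R_def poly_sum poly_mult by (simp add: kerA_0[OF i])
  have P_ap: "(\<lambda>x. P x a b) \<in> ?ap L" if ab: "a < s" "b < s" for a b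
  proof -
    let ?F = "\<lambda>x::nat \<Rightarrow> nat \<Rightarrow> nat \<Rightarrow> 'a. flat_entry A B s p q (a mod A) (lagrange_poly (nodesA (a mod A)) a)
      (b mod B) (lagrange_poly (nodesB (b mod B)) b) x"
    have "P x a b = ?F x - of_bool (a = b)" for x
      unfolding P_def flat_entry_def rowA_def colB_def ..
    moreover from this have "[:poly (?F x) 0:] = of_bool (a = b)" for x
      using P0[OF ab, of x] by (auto simp: of_bool_def one_pCons split: if_splits)
    ultimately have "(\<lambda>x. P x a b) = (\<lambda>x. ?F x - [:poly (?F x) 0:])" by simp
    also have "\<dots> \<in> ?ap L" using A B by (intro flat_entry_approx IH) auto
    finally show ?thesis .
  qed
  have Q_ap: "(\<lambda>x. Q x a) \<in> ?ap L" if a: "a < s" for a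
  proof -
    let ?F = "\<lambda>x::nat \<Rightarrow> nat \<Rightarrow> nat \<Rightarrow> 'a. flat_entry A B s p q (a mod A) (lagrange_poly (nodesA (a mod A)) a)
      j (vanishing_poly (nodesB j)) x"
    have F: "Q x a = ?F x" for x
      unfolding Q_def flat_entry_def rowA_def kerB_def ..
    have "(\<lambda>x. Q x a) = (\<lambda>x. ?F x - [:poly (?F x) 0:])"
      using Q0[OF a] unfolding F by simp
    also have "\<dots> \<in> ?ap L" using A j by (intro flat_entry_approx IH) auto
    finally show ?thesis .
  qed
  have R_ap: "(\<lambda>x. R x b) \<in> ?ap L" if b: "b < s" for b
  proof -
    let ?F = "\<lambda>x::nat \<Rightarrow> nat \<Rightarrow> nat \<Rightarrow> 'a. flat_entry A B s p q i (vanishing_poly (nodesA i))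
      (b mod B) (lagrange_poly (nodesB (b mod B)) b) x"
    have F: "R x b = ?F x" for x
      unfolding R_def flat_entry_def kerA_def colB_def ..
    have "(\<lambda>x. R x b) = (\<lambda>x. ?F x - [:poly (?F x) 0:])"
      using R0[OF b] unfolding F by simp
    also have "\<dots> \<in> ?ap L" using B i by (intro flat_entry_approx IH) auto
    finally show ?thesis .
  qed
  have v_ap: "(\<lambda>x. neumann s (P x) (Q x) k a) \<in> ?ap L" if "a < s" for k a
    using that
  proof (induction k arbitrary: a)
    case 0
    then show ?case using Q_ap by simp
  next
    case (Suc k)
    then show ?case
      unfolding neumann.simps by (intro approx_uminus approx_sum approx_mult P_ap) auto
  qed
  have v_order: "[:0, 1:] dvd neumann s (P x) (Q x) k a" if "a < s" for x k a
  proof -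
    have "[:0, 1:] ^ Suc k dvd neumann s (P x) (Q x) k a"
      using that P0 Q0 by (intro neumann_dvd) (auto simp: X_dvd_iff)
    then show ?thesis by (rule dvd_trans[rotated]) (simp only: power_Suc dvd_triv_left)
  qed
  \<comment> \<open>The extra order arises here: \<open>R\<close> and every Neumann term vanish at
    the base point.\<close>
  have "(\<lambda>x. \<Sum>k<L. \<Sum>b<s. R x b * neumann s (P x) (Q x) k b) \<in> ?ap (Suc L)"
    using R0 by (intro approx_sum approx_mult_gain R_ap v_ap L v_order) (auto simp: X_dvd_iff)
  then show ?thesis
  proof (rule approx_cong)
    fix x
    have "(\<Sum>k<L. \<Sum>b<s. R x b * neumann s (P x) (Q x) k b) =
        (\<Sum>t<s. kerA i x t * kerB j x t) - (\<Sum>t<s. kerA i x t * neumann s (N x) (kerB j x) L t)"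
      unfolding R_def P_def Q_def N_def
      using neumann_telescope[where X = "\<lambda>a t. rowA a x t" and Z = "\<lambda>t b. colB b x t"
        and u = "kerA i x" and w = "kerB j x" and s = s and L = L] .
    \<comment> \<open>The \<open>L\<close> factors \<open>N\<close> and the final
      \<open>kerB\<close> contribute one order each.\<close>
    moreover have "[:0, 1:] ^ Suc L dvd neumann s (N x) (kerB j x) L t" if "t < s" for t
      using that N0 kerB_0[OF j] by (intro neumann_dvd) (auto simp: X_dvd_iff)
    then have "[:0, 1:] ^ Suc L dvd (\<Sum>t<s. kerA i x t * neumann s (N x) (kerB j x) L t)"
      by (intro dvd_sum dvd_mult) auto
    ultimately show "[:0, 1:] ^ Suc L dvd (\<Sum>t<s. kerA i x t * kerB j x t) -
        (\<Sum>k<L. \<Sum>b<s. R x b * neumann s (P x) (Q x) k b)"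
      by simp
  qed
qed

text \<open>Both vanishing polynomials are monic, of degrees \<open>p\<close> and \<open>q\<close>,
  so the top coordinate enters the kernel entry with coefficient 1 and can be isolated.\<close>

lemma special_coord_eq:
  fixes x :: "nat \<Rightarrow> nat \<Rightarrow> nat \<Rightarrow> 'a::field_char_0"
  assumes i: "s mod A \<le> i" "i < A" and j: "s mod B \<le> j" "j < B"
  shows "ccoord A B s (p + q) i j (p + q) x = (\<Sum>t<s. kerA i x t * kerB j x t) -
     (\<Sum>(k, l)\<in>{..p} \<times> {..q} - {(p, q)}. smult (coeff (vanishing_poly (nodesA i)) k *
        coeff (vanishing_poly (nodesB j)) l) (ccoord A B s (p + q) i j (k + l) x))"
proof -
  let ?F = "flat_entry A B s p q i (vanishing_poly (nodesA i)) j (vanishing_poly (nodesB j)) x"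
  let ?h = "\<lambda>(k, l). smult (coeff (vanishing_poly (nodesA i)) k *
        coeff (vanishing_poly (nodesB j)) l) (ccoord A B s (p + q) i j (k + l) x)"
  have F: "?F = (\<Sum>t<s. kerA i x t * kerB j x t)"
    unfolding flat_entry_def kerA_def kerB_def ..
  have "poly ?F 0 = 0"
    unfolding F poly_sum poly_mult by (simp add: kerA_0[OF i])
  then have "?F = (\<Sum>k\<le>p. \<Sum>l\<le>q. ?h (k, l))"
    using flat_entry_centered[of A B s p q i "vanishing_poly (nodesA i)" j "vanishing_poly (nodesB j)" x]
    by simp
  also have "\<dots> = (\<Sum>kl\<in>{..p} \<times> {..q}. ?h kl)"
    by (simp add: sum.cartesian_product)
  also have "\<dots> = ?h (p, q) + (\<Sum>kl\<in>{..p} \<times> {..q} - {(p, q)}. ?h kl)"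
    by (rule sum.remove) auto
  also have "?h (p, q) = ccoord A B s (p + q) i j (p + q) x"
    using lead_coeff_vanishing_poly[of "nodesA i", where ?'a = 'a] card_residue_nodes_eq[OF i(2,1)]
      lead_coeff_vanishing_poly[of "nodesB j", where ?'a = 'a] card_residue_nodes_eq[OF j(2,1)] p q
    by simp
  finally show ?thesis unfolding F by simp
qed

text \<open>Induction on the order: free coordinates are variables, and for the others
  \<open>kernel_block_approx\<close> raises the order of the kernel entry by one.\<close>

lemma ccoord_approx:
  assumes "i < A" "j < B" "k \<le> p + q"
  shows "ccoord A B s (p + q) i j k \<in> approx (local_coord :: _ \<Rightarrow> _ \<Rightarrow> 'a::field_char_0 poly) free_coords L"
  using assms
proof (induction L arbitrary: i j k)
  case 0
  then show ?case by (intro approxI[OF pa_const]) auto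
next
  case (Suc L)
  let ?ap = "approx (local_coord :: _ \<Rightarrow> _ \<Rightarrow> 'a poly) free_coords"
  have free: "ccoord A B s (p + q) i j k \<in> ?ap M" if "(i, j, k) \<in> free_coords" for i j k M
    using polyalg_approx[OF pa_var[OF that, of local_coord]] by (simp add: local_coord_def)
  show ?case
  proof (cases "L = 0")
    \<comment> \<open>Order one has to be treated apart, because the gain requires \<open>L\<close>
      to be positive; the approximation by 0 suffices.\<close>
    case True
    then show ?thesis using ccoord_order by (intro approxI[OF pa_const[of 0]]) simp
  next
    case L: False
    show ?thesis
    proof (cases "(i, j, k) \<in> free_coords")
      case True
      then show ?thesis by (rule free)
    next
      case False
      then have i: "s mod A \<le> i" "i < A" and j: "s mod B \<le> j" "j < B" and k: "k = p + q"
        using Suc.prems unfolding free_coords_def by auto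
      have W: "(\<lambda>x. \<Sum>t<s. kerA i x t * kerB j x t) \<in> ?ap (Suc L)"
        using L by (intro kernel_block_approx Suc.IH i j) auto
      have rest: "(\<lambda>x. \<Sum>(k, l)\<in>{..p} \<times> {..q} - {(p, q)}. smult (coeff (vanishing_poly (nodesA i)) k *
        coeff (vanishing_poly (nodesB j)) l) (ccoord A B s (p + q) i j (k + l) x)) \<in> ?ap (Suc L)"
      proof (rule approx_sum)
        fix e assume "e \<in> {..p} \<times> {..q} - {(p, q)}"
        \<comment> \<open>Any pair other than \<open>(p, q)\<close> has
          \<open>k + l < p + q\<close>, so its coordinate is free.\<close>
        then obtain k l where e: "e = (k, l)" and "(i, j, k + l) \<in> free_coords"
          using i j unfolding free_coords_def by (cases e) auto
        then show "(\<lambda>x. case e of (k, l) \<Rightarrow> smult (coeff (vanishing_poly (nodesA i)) k *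
            coeff (vanishing_poly (nodesB j)) l) (ccoord A B s (p + q) i j (k + l) x)) \<in> ?ap (Suc L)"
          unfolding e prod.case by (intro approx_smult free)
      qed simp
      show ?thesis
        using approx_add[OF W approx_uminus[OF rest]]
        unfolding k special_coord_eq[OF i j, abs_def] by simp
    qed
  qed
qed

lemma coord_approx:
  assumes "i < A" "j < B" "k \<le> p + q"
  shows "coord A B s (p + q) i j k \<in> approx (local_coord :: _ \<Rightarrow> _ \<Rightarrow> 'a::field_char_0 poly) free_coords L"
proof -
  \<comment> \<open>The value at the base point is the same for all directions; the zero direction
    serves as representative.\<close>
  define c :: 'a where "c = poly (coord A B s (p + q) i j k (\<lambda>_ _ _. 0)) 0"
  have "poly (coord A B s (p + q) i j k x) 0 = c" for x
    unfolding c_def coord_def by (simp add: poly_sum)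
  then have "coord A B s (p + q) i j k x = ccoord A B s (p + q) i j k x + [:c:]" for x
    unfolding ccoord_def by simp
  then have "coord A B s (p + q) i j k = (\<lambda>x. ccoord A B s (p + q) i j k x + [:c:])" by (rule ext)
  then show ?thesis
    using approx_add[OF ccoord_approx[OF assms] approx_const] by simp
qed

lemma degree_coord_le:
  assumes "k \<le> d"
  shows "degree (coord A B s d i j k x) \<le> d + 2"
  unfolding coord_def
proof (intro degree_sum_le)
  fix t
  have U: "degree (line_vec A B x t m c) \<le> 1" for m c
    unfolding line_vec_def by simp
  have Up: "degree (line_vec A B x t m c ^ l) \<le> l" for m c l
    using order_trans[OF degree_power_le[of "line_vec A B x t m c" l] mult_right_mono[OF U[of m c], of l]] by simp
  show "degree (line_vec A B x t 0 i * line_vec A B x t 1 j *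
      (line_vec A B x t 2 0 ^ (d - k) * line_vec A B x t 2 1 ^ k)) \<le> d + 2"
    using degree_mult_le[of "line_vec A B x t 0 i * line_vec A B x t 1 j"
        "line_vec A B x t 2 0 ^ (d - k) * line_vec A B x t 2 1 ^ k"]
      degree_mult_le[of "line_vec A B x t 0 i" "line_vec A B x t 1 j"]
      degree_mult_le[of "line_vec A B x t 2 0 ^ (d - k)" "line_vec A B x t 2 1 ^ k"]
      U[of 0 i] U[of 1 j] Up[of 2 0 "d - k"] Up[of 2 1 k] assms by linarith
qed simp

end

section \<open>Coordinates of the Segre--Veronese variety\<close>

text \<open>In a factor of degree 1 a multi-index has sum 1, hence is a unit vector; in the line
  factor one exponent determines the other.\<close>

lemma sv_index_cases:
  assumes "\<alpha> \<in> sv_index [n, m, 1] [1, 1, d]"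
  obtains i j k where "i \<le> n" "j \<le> m" "k \<le> d"
    "\<forall>c\<le>n. \<alpha> 0 c = of_bool (c = i)" "\<forall>c\<le>m. \<alpha> 1 c = of_bool (c = j)" "\<alpha> 2 0 = d - k" "\<alpha> 2 1 = k"
proof -
  have all: "\<forall>i<3. (\<Sum>j\<le>[n, m, 1] ! i. \<alpha> i j) = [1, 1, d] ! i"
    using assms unfolding sv_index_def by simp
  have sums: "(\<Sum>c\<le>n. \<alpha> 0 c) = 1" "(\<Sum>c\<le>m. \<alpha> 1 c) = 1" "(\<Sum>c\<le>1. \<alpha> 2 c) = d"
    using all[rule_format, of 0] all[rule_format, of 1] all[rule_format, of 2] by simp_all
  obtain i where i: "i \<le> n" "\<alpha> 0 i = 1" "\<forall>c\<le>n. i \<noteq> c \<longrightarrow> \<alpha> 0 c = 0"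
    using sums(1) sum_eq_1_iff[of "{..n}" "\<alpha> 0"] by auto
  obtain j where j: "j \<le> m" "\<alpha> 1 j = 1" "\<forall>c\<le>m. j \<noteq> c \<longrightarrow> \<alpha> 1 c = 0"
    using sums(2) sum_eq_1_iff[of "{..m}" "\<alpha> 1"] by auto
  have "\<alpha> 2 0 + \<alpha> 2 1 = d" using sums(3) by simp
  then show ?thesis
    using i j by (intro that[of i j "\<alpha> 2 1"]) auto
qed

lemma prod_power_of_bool:
  fixes v :: "nat \<Rightarrow> 'b::comm_semiring_1"
  assumes "i \<le> n" "\<forall>c\<le>n. a c = of_bool (c = i)"
  shows "(\<Prod>c\<le>n. v c ^ a c) = v i"
proof -
  have "(\<Prod>c\<le>n. v c ^ a c) = (\<Prod>c\<le>n. if c = i then v c else 1)"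
    using assms(2) by (intro prod.cong) auto
  then show ?thesis using assms(1) by simp
qed

lemma sv_monomial:
  fixes u :: "nat \<Rightarrow> nat \<Rightarrow> 'b::comm_semiring_1"
  assumes "i \<le> n" "j \<le> m" "\<forall>c\<le>n. \<alpha> 0 c = of_bool (c = i)" "\<forall>c\<le>m. \<alpha> 1 c = of_bool (c = j)"
    "\<alpha> 2 0 = d - k" "\<alpha> 2 1 = k"
  shows "(\<Prod>i<length [n, m, 1]. \<Prod>j\<le>[n, m, 1] ! i. u i j ^ \<alpha> i j) =
    u 0 i * u 1 j * (u 2 0 ^ (d - k) * u 2 1 ^ k)"
proof -
  have "(\<Prod>i<length [n, m, 1]. \<Prod>j\<le>[n, m, 1] ! i. u i j ^ \<alpha> i j) =
      (\<Prod>c\<le>n. u 0 c ^ \<alpha> 0 c) * (\<Prod>c\<le>m. u 1 c ^ \<alpha> 1 c) * (\<Prod>c\<le>1. u 2 c ^ \<alpha> 2 c)"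
    by (simp add: numeral_3_eq_3 numeral_2_eq_2)
  also have "\<dots> = u 0 i * u 1 j * (u 2 0 ^ (d - k) * u 2 1 ^ k)"
    unfolding prod_power_of_bool[OF assms(1,3)] prod_power_of_bool[OF assms(2,4)]
    using assms(5,6) by simp
  finally show ?thesis .
qed

definition unit_index :: "nat \<Rightarrow> nat \<Rightarrow> nat \<Rightarrow> nat \<Rightarrow> nat \<Rightarrow> nat \<Rightarrow> nat" where
  "unit_index d i j k = (\<lambda>a b. if a = 0 then of_bool (b = i) else if a = 1 then of_bool (b = j)
     else if a = 2 then (if b = 0 then d - k else if b = 1 then k else 0) else 0)"

lemma unit_index_in:
  assumes "i \<le> n" "j \<le> m" "k \<le> d"
  shows "unit_index d i j k \<in> sv_index [n, m, 1] [1, 1, d]"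
proof -
  have "(\<Sum>c\<le>l. of_bool (c = b)) = (1::nat)" if "b \<le> l" for b l :: nat
    using that by (simp add: of_bool_def)
  then have "(\<Sum>c\<le>[n, m, 1] ! a. unit_index d i j k a c) = [1, 1, d] ! a" if "a < 3" for a
    using that assms by (auto simp: unit_index_def less_Suc_eq numeral_3_eq_3 numeral_2_eq_2)
  moreover have "unit_index d i j k a b = 0" if "a \<ge> 3 \<or> b > [n, m, 1] ! a" for a b
  proof (cases "a < 3")
    case True
    then show ?thesis
      using that assms by (auto simp: unit_index_def less_Suc_eq numeral_3_eq_3 numeral_2_eq_2)
  qed (auto simp: unit_index_def)
  ultimately show ?thesis unfolding sv_index_def by simp
qed

lemma sv_vec_unit_index:
  assumes "i \<le> n" "j \<le> m" "k \<le> d"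
  shows "sv_vec [n, m, 1] [1, 1, d] u (unit_index d i j k) = u 0 i * u 1 j * (u 2 0 ^ (d - k) * u 2 1 ^ k)"
proof -
  let ?\<alpha> = "unit_index d i j k"
  have "\<forall>c\<le>n. ?\<alpha> 0 c = of_bool (c = i)" "\<forall>c\<le>m. ?\<alpha> 1 c = of_bool (c = j)"
    "?\<alpha> 2 0 = d - k" "?\<alpha> 2 1 = k"
    by (auto simp: unit_index_def)
  from sv_monomial[OF assms(1,2) this, of u] show ?thesis
    unfolding sv_vec_def if_P[OF unit_index_in[OF assms]] .
qed

section \<open>Base points and the dimension bound for the secant cone\<close>

context flattening
begin

text \<open>A dual functional isolates each coefficient: the coordinates with classes of
  \<open>t0\<close>, weighted by the coefficients of its Lagrange polynomial, vanish at all other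
  base points. This makes the set of secant points nonempty.\<close>

lemma base_points_indep:
  assumes A1: "A = Suc n" and B1: "B = Suc m"
  shows "lin_indep_fam s (\<lambda>t. sv_vec [n, m, 1] [1, 1, p + q] (base_vec A B t :: _ \<Rightarrow> _ \<Rightarrow> 'a::field_char_0))"
  unfolding lin_indep_fam_def
proof (intro allI impI)
  fix c :: "nat \<Rightarrow> 'a" and t0
  let ?v = "\<lambda>t. sv_vec [n, m, 1] [1, 1, p + q] (base_vec A B t :: _ \<Rightarrow> _ \<Rightarrow> 'a)"
  assume z: "(\<lambda>x. \<Sum>t<s. c t * ?v t x) = (\<lambda>x. 0)" and t0: "t0 < s"
  define f :: "'a poly" where "f = lagrange_poly (nodesA (t0 mod A)) t0"
  define ix where "ix = unit_index (p + q) (t0 mod A) (t0 mod B)"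
  have deg: "degree f \<le> p" unfolding f_def using degree_lagrange_A[OF t0] .
  have bounds: "t0 mod A \<le> n" "t0 mod B \<le> m"
    using A1 B1 mod_less_divisor[of A t0] mod_less_divisor[of B t0] by linarith+
  have v: "?v t (ix k) = of_bool (t0 mod A = t mod A) * of_bool (t0 mod B = t mod B) * of_nat t ^ k"
    if "k \<le> p" for t k
    unfolding ix_def using that bounds by (subst sv_vec_unit_index) (auto simp: base_vec_def)
  have eval: "(\<Sum>k\<le>p. coeff f k * ?v t (ix k)) = of_bool (t0 = t)" if t: "t < s" for t
  proof -
    have "(\<Sum>k\<le>p. coeff f k * ?v t (ix k)) =
        of_bool (t0 mod A = t mod A) * of_bool (t0 mod B = t mod B) * (\<Sum>k\<le>p. coeff f k * of_nat t ^ k)"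
      unfolding sum_distrib_left by (intro sum.cong refl) (simp only: atMost_iff v mult_ac)
    also have "(\<Sum>k\<le>p. coeff f k * of_nat t ^ k) = poly f (of_nat t)"
      unfolding poly_altdef using deg by (intro sum.mono_neutral_right) (auto simp: coeff_eq_0)
    also have "of_bool (t0 mod A = t mod A) * of_bool (t0 mod B = t mod B) * poly f (of_nat t) = of_bool (t0 = t)"
      using t unfolding f_def by (auto simp: poly_lagrange_poly residue_nodes_def)
    finally show ?thesis .
  qed
  have "0 = (\<Sum>k\<le>p. coeff f k * (\<Sum>t<s. c t * ?v t (ix k)))"
    using fun_cong[OF z] by simp
  also have "\<dots> = (\<Sum>k\<le>p. \<Sum>t<s. c t * (coeff f k * ?v t (ix k)))"
    by (simp add: sum_distrib_left mult.left_commute)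
  also have "\<dots> = (\<Sum>t<s. c t * (\<Sum>k\<le>p. coeff f k * ?v t (ix k)))"
    unfolding sum_distrib_left by (rule sum.swap)
  also have "\<dots> = (\<Sum>t<s. of_bool (t0 = t) * c t)"
    by (intro sum.cong refl) (simp only: lessThan_iff eval mult.commute)
  also have "\<dots> = c t0" using t0 by (rule sum_of_bool_delta)
  finally show "c t0 = 0" by simp
qed

lemma base_points_in_cone:
  assumes A1: "A = Suc n" and B1: "B = Suc m"
  shows "sv_vec [n, m, 1] [1, 1, p + q] (base_vec A B t :: _ \<Rightarrow> _ \<Rightarrow> 'a::field_char_0) \<in> sv_cone [n, m, 1] [1, 1, p + q]"
proof -
  have "\<exists>j\<le>[n, m, 1] ! i. (base_vec A B t i j :: 'a) \<noteq> 0" if "i < 3" for i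
  proof -
    consider "i = 0" | "i = 1" | "i = 2" using \<open>i < 3\<close> by linarith
    then show ?thesis
    proof cases
      case 1
      have "t mod A \<le> n" using A1 mod_less_divisor[of A t] by linarith
      then show ?thesis using 1 by (intro exI[of _ "t mod A"]) (simp add: base_vec_def)
    next
      case 2
      have "t mod B \<le> m" using B1 mod_less_divisor[of B t] by linarith
      then show ?thesis using 2 by (intro exI[of _ "t mod B"]) (simp add: base_vec_def)
    next
      case 3
      then show ?thesis by (intro exI[of _ 0]) (simp add: base_vec_def)
    qed
  qed
  then show ?thesis unfolding sv_cone_def by auto
qed

lemma zdim_secant_cone_le:
  assumes A1: "A = Suc n" and B1: "B = Suc m"
  shows "zdim (sv_index [n, m, 1] [1, 1, p + q])
      (secant_cone s [n, m, 1] [1, 1, p + q] :: (_ \<Rightarrow> 'a::field_char_0) set)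
    \<le> A * B * (p + q + 1) - (A - s mod A) * (B - s mod B)"
proof -
  define I where "I = sv_index [n, m, 1] [1, 1, p + q]"
  define S :: "((nat \<Rightarrow> nat \<Rightarrow> nat) \<Rightarrow> 'a) set" where
    "S = {(\<lambda>x. \<Sum>t<s. c t * v t x) | c v.
        (\<forall>t<s. v t \<in> sv_cone [n, m, 1] [1, 1, p + q]) \<and> lin_indep_fam s v}"
  define \<Phi> :: "(nat \<Rightarrow> nat \<Rightarrow> nat \<Rightarrow> 'a) \<Rightarrow> (nat \<Rightarrow> nat \<Rightarrow> nat) \<Rightarrow> 'a poly" where
    "\<Phi> x \<alpha> = (if \<alpha> \<in> I then \<Sum>t<s. \<Prod>i<length [n, m, 1]. \<Prod>j\<le>[n, m, 1] ! i. line_vec A B x t i j ^ \<alpha> i j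
       else 0)" for x \<alpha>
  have \<Phi>_coord: "\<exists>i<A. \<exists>j<B. \<exists>k\<le>p + q. (\<lambda>x. \<Phi> x \<alpha>) = coord A B s (p + q) i j k" if "\<alpha> \<in> I" for \<alpha>
  proof -
    from that obtain i j k where ijk: "i \<le> n" "j \<le> m" "k \<le> p + q"
      "\<forall>c\<le>n. \<alpha> 0 c = of_bool (c = i)" "\<forall>c\<le>m. \<alpha> 1 c = of_bool (c = j)" "\<alpha> 2 0 = p + q - k" "\<alpha> 2 1 = k"
      unfolding I_def by (rule sv_index_cases)
    have "(\<lambda>x. \<Phi> x \<alpha>) = coord A B s (p + q) i j k"
      unfolding \<Phi>_def coord_def using that by (simp only: if_True sv_monomial[of i n j m \<alpha> "p + q" k, OF ijk(1,2,4-7)])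
    then show ?thesis using ijk A1 B1 by (metis less_Suc_eq_le)
  qed
  interpret line_expansion I \<Phi> local_coord free_coords "p + q + 2" S
  proof
    show "finite free_coords" unfolding free_coords_def by simp
    show "[:0, 1:] dvd local_coord j x" for j and x :: "nat \<Rightarrow> nat \<Rightarrow> nat \<Rightarrow> 'a"
      by (cases j) (simp add: local_coord_def ccoord_order)
    show "degree (\<Phi> x \<alpha>) \<le> p + q + 2" if \<alpha>: "\<alpha> \<in> I" for \<alpha> x
    proof -
      obtain i j k where "k \<le> p + q" "(\<lambda>x. \<Phi> x \<alpha>) = coord A B s (p + q) i j k"
        using \<Phi>_coord[OF \<alpha>] by blast
      then show ?thesis using degree_coord_le[of k "p + q" i j x] fun_cong by metis
    qed
    show "(\<lambda>x. \<Phi> x \<alpha>) \<in> approx local_coord free_coords L" if "\<alpha> \<in> I" for \<alpha> L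
      using \<Phi>_coord[OF that] coord_approx by force
    show "S \<subseteq> aspace I"
    proof
      fix z assume "z \<in> S"
      then obtain c v where z: "z = (\<lambda>x. \<Sum>t<s. c t * v t x)" and v: "\<forall>t<s. v t \<in> sv_cone [n, m, 1] [1, 1, p + q]"
        unfolding S_def by blast
      have "v t \<alpha> = 0" if "\<alpha> \<notin> I" "t < s" for \<alpha> t
        using v that unfolding sv_cone_def sv_vec_def I_def by auto
      then show "z \<in> aspace I" unfolding aspace_def z by auto
    qed
    show "\<exists>x. z = (\<lambda>\<alpha>. poly (\<Phi> x \<alpha>) 1)" if zS: "z \<in> S" for z
    proof -
      obtain c v where z: "z = (\<lambda>x. \<Sum>t<s. c t * v t x)" and v: "\<forall>t<s. v t \<in> sv_cone [n, m, 1] [1, 1, p + q]"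
        using zS unfolding S_def by blast
      have "\<forall>t. \<exists>u. t < s \<longrightarrow> v t = sv_vec [n, m, 1] [1, 1, p + q] u"
        using v unfolding sv_cone_def by blast
      then obtain u where u: "\<And>t. t < s \<Longrightarrow> v t = sv_vec [n, m, 1] [1, 1, p + q] (u t)"
        by metis
      \<comment> \<open>The scalar \<open>c t\<close> is absorbed into the first factor, which has
        degree 1.\<close>
      define w where "w t i j = (if i = 0 then c t * u t i j else u t i j)" for t i j :: nat
      \<comment> \<open>With this direction the line through the base point reaches \<open>w\<close>
        at parameter 1.\<close>
      define x where "x t i j = w t i j - base_vec A B t i j" for t i j
      have lin: "poly (line_vec A B x t i j) 1 = w t i j" for t i j
        by (simp add: line_vec_def x_def)
      have "z \<alpha> = poly (\<Phi> x \<alpha>) 1" for \<alpha>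
      proof (cases "\<alpha> \<in> I")
        case True
        then obtain i j k where ijk: "i \<le> n" "j \<le> m" "k \<le> p + q"
          "\<forall>c\<le>n. \<alpha> 0 c = of_bool (c = i)" "\<forall>c\<le>m. \<alpha> 1 c = of_bool (c = j)" "\<alpha> 2 0 = p + q - k" "\<alpha> 2 1 = k"
          unfolding I_def by (rule sv_index_cases)
        note mono = sv_monomial[of i n j m \<alpha> "p + q" k, OF ijk(1,2,4-7)]
        have "v t \<alpha> = u t 0 i * u t 1 j * (u t 2 0 ^ (p + q - k) * u t 2 1 ^ k)" if "t < s" for t
          unfolding u[OF that] sv_vec_def mono using True by (simp add: I_def)
        then have "z \<alpha> = (\<Sum>t<s. w t 0 i * w t 1 j * (w t 2 0 ^ (p + q - k) * w t 2 1 ^ k))"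
          unfolding z by (intro sum.cong) (auto simp: w_def)
        moreover have "\<Phi> x \<alpha> = (\<Sum>t<s. line_vec A B x t 0 i * line_vec A B x t 1 j *
            (line_vec A B x t 2 0 ^ (p + q - k) * line_vec A B x t 2 1 ^ k))"
          unfolding \<Phi>_def mono using True by simp
        ultimately show ?thesis by (simp add: poly_sum lin)
      next
        case False
        then have "v t \<alpha> = 0" if "t < s" for t
          using u[OF that] by (simp add: sv_vec_def I_def)
        then show ?thesis using False by (simp add: z \<Phi>_def)
      qed
      then show ?thesis by blast
    qed
  qed
  have "(\<lambda>x. \<Sum>t<s. 1 * sv_vec [n, m, 1] [1, 1, p + q] (base_vec A B t :: _ \<Rightarrow> _ \<Rightarrow> 'a) x) \<in> S"
    unfolding S_def mem_Collect_eq
    by (intro exI[of _ "\<lambda>_. 1"] exI[of _ "\<lambda>t. sv_vec [n, m, 1] [1, 1, p + q] (base_vec A B t)"]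
        conjI allI impI refl base_points_in_cone base_points_indep assms)
  then have "zdim I (zclosure I S) \<le> card free_coords" by (intro zdim_le) blast
  then show ?thesis unfolding card_free_coords secant_cone_def S_def I_def .
qed

end

section \<open>Comparison with the expected dimension\<close>

theorem mainTheorem6:
  fixes n a d e s :: nat
  assumes "n \<ge> 1" and "d \<ge> 2" and "1 \<le> e" and "e \<le> d - 1" and "s \<ge> 1"
    and "max ((n + 1) * (d - e) + 1) ((n + a + 1) * e + 1) \<le> s"
    and "int n \<ge> int (n + 1) * int (d - e + 1) - int s"
    and "int (n + 1) * int (d - e + 1) - int s > 0"
    and "int (n + a) \<ge> int (n + a + 1) * int (e + 1) - int s"
    and "int (n + a + 1) * int (e + 1) - int s > 0"
  shows "sigma_defective TYPE('a::{alg_closed_field, field_char_0}) s [n, n + a, 1] [1, 1, d]"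
proof -
  define A B p where "A = n + 1" and "B = n + a + 1" and "p = d - e"
  have d: "d = p + e" using assms(2-4) by (simp add: p_def)
  have lo: "A * p + 1 \<le> s" "B * e + 1 \<le> s"
    using assms(6) unfolding A_def B_def p_def by auto
  have "int s < int (A * (p + 1))" "int s < int (B * (e + 1))"
    using assms(8,10) unfolding A_def B_def p_def by (simp_all only: of_nat_mult)
  then have hi: "s < A * p + A" "s < B * e + B"
    unfolding of_nat_less_iff by simp_all
  have pos: "A > 0" "B > 0" by (auto simp: A_def B_def)
  have quot: "s div A = p" "s div B = e"
    using lo hi by (intro div_nat_eqI; simp add: algebra_simps)+
  define r t where "r = s mod A" and "t = s mod B"
  \<comment> \<open>The strict lower bounds on \<open>s\<close> make both remainders positive; their
    product is the defect.\<close>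
  have r: "s = A * p + r" "1 \<le> r" "r < A" and t: "s = B * e + t" "1 \<le> t" "t < B"
    using lo pos quot mult_div_mod_eq[of A s] mult_div_mod_eq[of B s] unfolding r_def t_def by auto
  interpret flattening A B s p e
    using pos quot by unfold_locales
  define M where "M = A * B * (p + e + 1) - (A - r) * (B - t)"
  have "zdim (sv_index [n, n + a, 1] [1, 1, d]) (secant_cone s [n, n + a, 1] [1, 1, d] :: (_ \<Rightarrow> 'a) set) \<le> M"
    using zdim_secant_cone_le[of n "n + a"] unfolding d M_def r_def t_def by (simp add: A_def B_def)
  moreover have "M < A * B * (p + e + 1)"
    using r t pos unfolding M_def by (intro diff_less) auto
  moreover have "M < s * (A + B)"
  proof -
    obtain r' t' where A': "A = r + r'" and B': "B = t + t'"
      using r(3) t(3) less_imp_add_positive by metis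
    have "s * (A + B) = A * (B * e + t) + B * (A * p + r)"
      using r(1) t(1) by (metis add_mult_distrib2 mult.commute)
    \<comment> \<open>Thus \<open>M\<close> equals \<open>s * (A + B) - r * t\<close> whenever its
      subtraction does not truncate.\<close>
    then have "s * (A + B) + r' * t' = A * B * (p + e + 1) + r * t"
      unfolding A' B' by (simp add: algebra_simps)
    moreover have "r * t > 0" using r t by simp
    moreover have "M = A * B * (p + e + 1) - r' * t'" unfolding M_def A' B' by simp
    \<comment> \<open>Covers the case of a truncated subtraction, in which \<open>M\<close> is
      0.\<close>
    moreover have "s * (A + B) > 0" using r pos by simp
    ultimately show ?thesis by linarith
  qed
  moreover have "Dsv [n, n + a, 1] + 1 = A + B"
    by (simp add: Dsv_def A_def B_def numeral_3_eq_3)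
  moreover have "Nsv [n, n + a, 1] [1, 1, d] = A * B * (p + e + 1)"
    by (simp add: Nsv_def A_def B_def d numeral_3_eq_3 algebra_simps)
  ultimately show ?thesis
    unfolding sigma_defective_def proj_dim_def by simp
qed

end
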